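(* Define $F:\mathrm{SCH}\to\Lambda$ by $F_P=\mathrm{LLTe}_P(\mathbf{x};q)$. Then $F$ satisfies: (i) $F_{\mathtt{n}\mathtt{d}^k\mathtt{e}}=\mathrm{e}_{k+1}$ for all integers $k\ge0$; (ii) $F_{PQ}=F_PF_Q$ for all $P,Q\in\mathrm{SCH}$; (iii) for all words $U,V\in\{\mathtt{n},\mathtt{d},\mathtt{e}\}^*$ with $U\mathtt{d}V\in\mathrm{SCH}$, $F_{U\mathtt{n}\mathtt{e}V}-F_{U\mathtt{e}\mathtt{n}V}=(q-1)F_{U\mathtt{d}V}$; (iv) whenever $P\in\mathrm{SCH}$ and $(x,z)\in\mathbb{Z}^2$ is a point on $P$ with $x+1<z$ such that the bounce path of $P$ at $(x,z)$ has exactly one bounce point and the bounce decomposition of $P$ at $(x,z)$ is $P=Us\cdot tV\mathtt{d}\cdot\mathtt{e}W$ with $V\in\{\mathtt{n},\mathtt{d}\}^*$ and $st\in\{\mathtt{n}\mathtt{n},\mathtt{d}\mathtt{n}\}$, we have $F_P=qF_{U\mathtt{n}\mathtt{n}V\mathtt{e}\mathtt{d}W}$ if $st=\mathtt{n}\mathtt{n}$ and $F_P=F_{U\mathtt{n}\mathtt{d}V\mathtt{e}\mathtt{d}W}$ if $st=\mathtt{d}\mathtt{n}$.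
   Context: Let $K=\mathbb{Q}(q)$ and $\Lambda$ the algebra of symmetric functions over $K$ in $\mathbf{x}=(x_1,x_2,\dots)$; $\mathrm{e}_k$ are elementary symmetric functions, $\mathrm{e}_\lambda=\prod_i\mathrm{e}_{\lambda_i}$. Steps: $\mathtt{n}=(0,1)$, $\mathtt{e}=(1,0)$, $\mathtt{d}=(1,1)$. A Schröder path of size $n$ is a lattice path from $(0,0)$ to $(n,n)$ with steps in $\{\mathtt{n},\mathtt{e},\mathtt{d}\}$ such that every east and every diagonal step is preceded by strictly more north steps than east steps. Paths are words in $\{\mathtt{n},\mathtt{d},\mathtt{e}\}^*$, $PQ$ is concatenation, $\mathrm{SCH}$ is the set of all Schröder paths. Bounce path of $P$ (size $n$) at a lattice point $(u_1,u_0)$ on $P$: move south from $(u_1,u_0)$ to $(u_1,u_1)$, then west until first reaching a point $(u_2,u_1)$ of $P$; if that point lies between two diagonal steps of $P$, continue south to $(u_2,u_2)$ and west to a point $(u_3,u_2)$ of $P$, and so on, stopping at the first point $(u_{k+1},u_k)$ incident to a north or east step of $P$. The points $(u_i,u_i)$, $1\le i\le k$, are the bounce points. The bounce decomposition at $(u_1,u_0)$ is the unique factorisation $P=Us_1\cdot s_2Vs_3\cdot s_4W$ ($s_i$ single steps, $U,V,W$ words) where $Us_1$ is the part of $P$ from $(0,0)$ to $(u_{k+1},u_k)$ and $s_4W$ is the part from $(u_1,u_0)$ to $(n,n)$; dots are only markers. For $P$ of size $n$, $\Gamma_P$ is the graph on $[n]$ where, for $1\le x<y\le n$, $\{x,y\}$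 is a non-strict edge if the unit square $[x-1,x]\times[y-1,y]$ lies in the region between $P$ and the line $y=x$, and a strict edge if $P$ has a diagonal step from $(x-1,y-1)$ to $(x,y)$. An orientation of $\Gamma_P$ is a set $\theta$ of directed edges containing, for each edge $\{u,v\}$, exactly one of $u\to v$, $v\to u$. $\mathcal{O}(P)$ is the set of orientations in which each strict edge $\{u,v\}$, $u<v$, is oriented $u\to v$. An edge $u\to v\in\theta$ is ascending if $u<v$ and $\{u,v\}$ is non-strict; $\mathrm{asc}(\theta)$ is the number of ascending edges. For a vertex $u$, $\mathrm{hrv}_\theta(u)$ is the maximal $v$ such that there is a directed path (possibly of length $0$) from $u$ to $v$ in $\theta$ using only strict and ascending edges. $\lambda(\theta)$ is the integer partition given by the sizes of the classes of vertices having the same value of $\mathrm{hrv}_\theta$. Finally $\mathrm{LLTe}_P(\mathbf{x};q)\in\Lambda$ is defined by $\mathrm{LLTe}_P(\mathbf{x};q+1)=\sum_{\theta\in\mathcal{O}(P)}q^{\mathrm{asc}(\theta)}\mathrm{e}_{\lambda(\theta)}(\mathbf{x})$, i.e. $\mathrm{LLTe}_P(\mathbf{x};q)=\sum_{\theta\in\mathcal{O}(P)}(q-1)^{\mathrm{asc}(\theta)}\mathrm{e}_{\lambda(\theta)}(\mathbf{x})$. *)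

theory Defs
  imports
    "HOL-Analysis.Line_Segment"
    "HOL-Library.Multiset"
    "HOL-Computational_Algebra.Polynomial"
    "HOL-Computational_Algebra.Fraction_Field"
begin

section \<open>The algebra of symmetric functions\<close>

text \<open>
  A monomial in the variables \<open>x\<^sub>0, x\<^sub>1, \<dots>\<close> is a finite multiset of variable indices, and a formal
  power series is the function sending each monomial to its coefficient. Symmetric functions are
  the power series of bounded degree that are invariant under permuting the variables.
\<close>

definition symmetric_series :: "(nat multiset \<Rightarrow> 'a::zero) \<Rightarrow> bool" where
  "symmetric_series f \<longleftrightarrow>
     (\<exists>d. \<forall>m. size m > d \<longrightarrow> f m = 0) \<and> (\<forall>\<pi> m. bij \<pi> \<longrightarrow> f (image_mset \<pi> m) = f m)"

typedef (overloaded) 'a sym_fun = "{f :: nat multiset \<Rightarrow> 'a::zero. symmetric_series f}"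
  morphisms sf_coeff Abs_sym_fun
  by (rule exI[of _ "\<lambda>_. 0"]) (simp add: symmetric_series_def)

setup_lifting type_definition_sym_fun

definition mset_splits :: "'b multiset \<Rightarrow> ('b multiset \<times> 'b multiset) set" where
  "mset_splits m = {(a, b). a + b = m}"

lemma finite_mset_splits [simp]: "finite (mset_splits m)"
proof -
  let ?L = "{xs. set xs \<subseteq> set_mset m \<and> length xs \<le> size m}"
  have sub: "a \<in> mset ` ?L" if "a \<subseteq># m" for a
  proof -
    obtain xs where "a = mset xs" by (metis ex_mset)
    with that show ?thesis
      by (metis (mono_tags, lifting) image_eqI mem_Collect_eq mset_subset_eqD set_mset_mset
            size_mset size_mset_mono subsetI)
  qed
  have "mset_splits m \<subseteq> (mset ` ?L) \<times> (mset ` ?L)"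
    using sub by (auto simp: mset_splits_def simp del: mem_Collect_eq)
  moreover have "finite ?L" by (intro finite_lists_length_le) simp
  ultimately show ?thesis by (meson finite_SigmaI finite_imageI finite_subset)
qed

definition conv :: "('b multiset \<Rightarrow> 'a::comm_ring_1) \<Rightarrow> ('b multiset \<Rightarrow> 'a) \<Rightarrow> 'b multiset \<Rightarrow> 'a" where
  "conv f g m = (\<Sum>(a, b)\<in>mset_splits m. f a * g b)"

lemma conv_assoc: "conv (conv f g) h m = conv f (conv g h) m"
proof -
  have "conv (conv f g) h m =
      (\<Sum>p\<in>mset_splits m. \<Sum>r\<in>mset_splits (fst p). f (fst r) * g (snd r) * h (snd p))"
    by (simp add: conv_def case_prod_unfold sum_distrib_right)
  also have "\<dots> = (\<Sum>(p, r)\<in>Sigma (mset_splits m) (\<lambda>p. mset_splits (fst p)).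
      f (fst r) * g (snd r) * h (snd p))"
    by (rule sum.Sigma) auto
  also have "\<dots> = (\<Sum>(p, r)\<in>Sigma (mset_splits m) (\<lambda>p. mset_splits (snd p)).
      f (fst p) * g (fst r) * h (snd r))"
    by (rule sum.reindex_bij_witness
          [where i = "\<lambda>((a, b), (c, d)). ((a + c, d), (a, c))"
             and j = "\<lambda>((a, b), (c, d)). ((c, d + b), (d, b))"])
       (auto simp: mset_splits_def add_ac)
  also have "\<dots> = (\<Sum>p\<in>mset_splits m. \<Sum>r\<in>mset_splits (snd p). f (fst p) * g (fst r) * h (snd r))"
    by (rule sum.Sigma[symmetric]) auto
  also have "\<dots> = conv f (conv g h) m"
    by (simp add: conv_def case_prod_unfold sum_distrib_left mult.assoc)
  finally show ?thesis .
qed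

lemma conv_commute: "conv f g m = conv g f m"
  unfolding conv_def
  by (rule sum.reindex_bij_witness[where i = prod.swap and j = prod.swap])
     (auto simp: mset_splits_def add_ac)

lemma conv_one_left:
  fixes g :: "'b multiset \<Rightarrow> 'a::comm_ring_1"
  shows "conv (\<lambda>m. if m = {#} then 1 else 0) g m = g m"
proof -
  have "conv (\<lambda>m. if m = {#} then 1 else 0) g m = (\<Sum>p\<in>{({#} :: 'b multiset, m)}. g (snd p))"
    unfolding conv_def case_prod_unfold
    by (rule sum.mono_neutral_cong_right[OF finite_mset_splits]) (auto simp: mset_splits_def)
  then show ?thesis by simp
qed

lemma conv_add_left: "conv (\<lambda>m. f m + g m) h m = conv f h m + conv g h m"
  by (simp add: conv_def case_prod_unfold distrib_right sum.distrib)

lemma conv_bounded: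
  fixes f g :: "'b multiset \<Rightarrow> 'a::comm_ring_1"
  assumes "\<forall>m. size m > d \<longrightarrow> f m = 0" "\<forall>m. size m > e \<longrightarrow> g m = 0"
  shows "\<forall>m. size m > d + e \<longrightarrow> conv f g m = 0"
  unfolding conv_def
proof (intro allI impI sum.neutral ballI)
  fix m :: "'b multiset" and p assume "d + e < size m" "p \<in> mset_splits m"
  then have "size (fst p) > d \<or> size (snd p) > e"
    by (auto simp: mset_splits_def)
  then show "(case p of (a, b) \<Rightarrow> f a * g b) = 0"
    using assms by (auto simp: case_prod_unfold)
qed

lemma conv_symmetric:
  assumes f: "\<And>m. f (image_mset \<pi> m) = f m" and g: "\<And>m. g (image_mset \<pi> m) = g m"
    and "bij \<pi>"
  shows "conv f g (image_mset \<pi> m) = conv f g m"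
proof -
  have inv1: "image_mset (inv \<pi>) (image_mset \<pi> a) = a" for a
    using \<open>bij \<pi>\<close> by (simp add: multiset.map_comp bij_is_inj)
  have inv2: "image_mset \<pi> (image_mset (inv \<pi>) a) = a" for a
    using \<open>bij \<pi>\<close> by (simp add: multiset.map_comp bij_is_surj[THEN surj_iff[THEN iffD1]])
  have f_inv: "f (image_mset (inv \<pi>) a) = f a" and g_inv: "g (image_mset (inv \<pi>) a) = g a" for a
    using f[of "image_mset (inv \<pi>) a"] g[of "image_mset (inv \<pi>) a"] by (simp_all only: inv2)
  have split: "image_mset (inv \<pi>) a + image_mset (inv \<pi>) b = m" if "a + b = image_mset \<pi> m" for a b
    unfolding image_mset_union[symmetric] that by (rule inv1)
  show ?thesis
    unfolding conv_def
    by (rule sum.reindex_bij_witness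
          [where i = "\<lambda>(a, b). (image_mset \<pi> a, image_mset \<pi> b)"
             and j = "\<lambda>(a, b). (image_mset (inv \<pi>) a, image_mset (inv \<pi>) b)"])
       (clarsimp simp: mset_splits_def inv1 inv2 f_inv g_inv split
          simp del: multiset.map_comp; fail)+
qed

instantiation sym_fun :: (comm_ring_1) comm_ring_1
begin

lift_definition zero_sym_fun :: "'a sym_fun" is "\<lambda>_. 0" by (simp add: symmetric_series_def)

lift_definition one_sym_fun :: "'a sym_fun" is "\<lambda>m. if m = {#} then 1 else 0"
  by (auto simp: symmetric_series_def intro!: exI[of _ 0])

lift_definition plus_sym_fun :: "'a sym_fun \<Rightarrow> 'a sym_fun \<Rightarrow> 'a sym_fun" is "\<lambda>f g m. f m + g m"
proof -
  fix f g :: "nat multiset \<Rightarrow> 'a"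
  assume fg: "symmetric_series f" "symmetric_series g"
  then obtain d e where "\<forall>m. d < size m \<longrightarrow> f m = 0" "\<forall>m. e < size m \<longrightarrow> g m = 0"
    by (auto simp: symmetric_series_def)
  then have "\<exists>d. \<forall>m. d < size m \<longrightarrow> f m + g m = 0" by (intro exI[of _ "max d e"]) auto
  then show "symmetric_series (\<lambda>m. f m + g m)" using fg by (simp add: symmetric_series_def)
qed

lift_definition uminus_sym_fun :: "'a sym_fun \<Rightarrow> 'a sym_fun" is "\<lambda>f m. - f m"
  by (simp add: symmetric_series_def)

definition minus_sym_fun :: "'a sym_fun \<Rightarrow> 'a sym_fun \<Rightarrow> 'a sym_fun" where
  "minus_sym_fun f g = f + (- g)"

lift_definition times_sym_fun :: "'a sym_fun \<Rightarrow> 'a sym_fun \<Rightarrow> 'a sym_fun" is conv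
proof -
  fix f g :: "nat multiset \<Rightarrow> 'a"
  assume fg: "symmetric_series f" "symmetric_series g"
  then obtain d e where "\<forall>m. d < size m \<longrightarrow> f m = 0" "\<forall>m. e < size m \<longrightarrow> g m = 0"
    by (auto simp: symmetric_series_def)
  from conv_bounded[OF this] have "\<exists>d. \<forall>m. d < size m \<longrightarrow> conv f g m = 0" by blast
  moreover have "conv f g (image_mset \<pi> m) = conv f g m" if "bij \<pi>" for \<pi> m
    using fg that by (intro conv_symmetric) (auto simp: symmetric_series_def)
  ultimately show "symmetric_series (conv f g)" by (simp add: symmetric_series_def)
qed

instance
proof
  fix a b c :: "'a sym_fun"
  show "a + b + c = a + (b + c)" by transfer (simp add: add_ac)
  show "a + b = b + a" by transfer (simp add: add_ac)
  show "0 + a = a" by transfer simp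
  show "- a + a = 0" by transfer simp
  show "a - b = a + - b" by (simp add: minus_sym_fun_def)
  show "a * b * c = a * (b * c)" by transfer (rule ext, rule conv_assoc)
  show "a * b = b * a" by transfer (rule ext, rule conv_commute)
  show "1 * a = a" by transfer (rule ext, rule conv_one_left)
  show "(a + b) * c = a * c + b * c" by transfer (rule ext, rule conv_add_left)
  show "(0 :: 'a sym_fun) \<noteq> 1" by transfer (auto dest: fun_cong[of _ _ "{#}"])
qed

end

lift_definition sf_scale :: "'a::comm_ring_1 \<Rightarrow> 'a sym_fun \<Rightarrow> 'a sym_fun" (infixr "*\<^sub>K" 75)
  is "\<lambda>c f m. c * f m"
  by (simp add: symmetric_series_def) (metis mult_zero_right)

lemma sf_scale_algebra:
  fixes c d :: "'a::comm_ring_1"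
  shows
  "c *\<^sub>K (f + g) = c *\<^sub>K f + c *\<^sub>K g" "(c + d) *\<^sub>K f = c *\<^sub>K f + d *\<^sub>K f"
  "c *\<^sub>K d *\<^sub>K f = (c * d) *\<^sub>K f" "1 *\<^sub>K f = f"
  "(c *\<^sub>K f) * g = c *\<^sub>K (f * g)" "f * (c *\<^sub>K g) = c *\<^sub>K (f * g)"
proof -
  show "c *\<^sub>K (f + g) = c *\<^sub>K f + c *\<^sub>K g" by transfer (simp add: distrib_left)
  show "(c + d) *\<^sub>K f = c *\<^sub>K f + d *\<^sub>K f" by transfer (simp add: distrib_right)
  show "c *\<^sub>K d *\<^sub>K f = (c * d) *\<^sub>K f" by transfer (simp add: mult.assoc)
  show "1 *\<^sub>K f = f" by transfer simp
  show *: "(c *\<^sub>K f) * g = c *\<^sub>K (f * g)" for f g :: "'a sym_fun"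
    by transfer (simp add: fun_eq_iff conv_def case_prod_unfold sum_distrib_left mult.assoc)
  show "f * (c *\<^sub>K g) = c *\<^sub>K (f * g)"
    using *[of g f] by (simp add: mult.commute)
qed

text \<open>The monomials of the elementary symmetric function of degree \<open>k\<close> are the squarefree ones.\<close>

lift_definition elem_sym :: "nat \<Rightarrow> 'a::comm_ring_1 sym_fun"
  is "\<lambda>k m. if size m = k \<and> (\<forall>i. count m i \<le> 1) then 1 else 0"
proof -
  fix k :: nat
  have "(\<forall>i. count (image_mset \<pi> m) i \<le> 1) \<longleftrightarrow> (\<forall>i. count m i \<le> 1)" if "bij \<pi>"
    for \<pi> :: "nat \<Rightarrow> nat" and m
  proof -
    have "count (image_mset \<pi> m) (\<pi> i) = count m i" for i
      using that by (induction m) (auto simp: bij_is_inj inj_eq)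
    then show ?thesis using that by (metis bij_pointE)
  qed
  then show "symmetric_series (\<lambda>m. if size m = k \<and> (\<forall>i. count m i \<le> 1) then 1 else (0 :: 'a))"
    by (auto simp: symmetric_series_def intro!: exI[of _ k])
qed

text \<open>Integer partitions are represented by the multiset of their parts.\<close>

definition elem_sym_part :: "nat multiset \<Rightarrow> 'a::comm_ring_1 sym_fun" where
  "elem_sym_part \<mu> = (\<Prod>k\<in>#\<mu>. elem_sym k)"

type_synonym K = "rat poly fract"

definition q :: K where "q = Fract [:0, 1:] 1"


section \<open>Schroeder paths\<close>

datatype step = North | East | Diag

fun step_vec :: "step \<Rightarrow> nat \<times> nat" where
  "step_vec North = (0, 1)"
| "step_vec East = (1, 0)"
| "step_vec Diag = (1, 1)"

definition endpoint :: "step list \<Rightarrow> nat \<times> nat" where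
  "endpoint P = (\<Sum>s\<leftarrow>P. step_vec s)"

definition schroeder_path :: "nat \<Rightarrow> step list \<Rightarrow> bool" where
  "schroeder_path n P \<longleftrightarrow> endpoint P = (n, n) \<and>
     (\<forall>A s B. P = A @ [s] @ B \<and> s \<in> {East, Diag} \<longrightarrow> count_list A North > count_list A East)"

definition SCH :: "step list set" where
  "SCH = {P. \<exists>n. schroeder_path n P}"

definition lattice_points :: "step list \<Rightarrow> (nat \<times> nat) set" where
  "lattice_points P = {endpoint A | A B. P = A @ B}"


section \<open>Bounce paths and bounce decompositions\<close>

definition between_diagonals :: "step list \<Rightarrow> nat \<times> nat \<Rightarrow> bool" where
  "between_diagonals P p \<longleftrightarrow> (\<exists>A B. P = A @ [Diag] @ [Diag] @ B \<and> endpoint (A @ [Diag]) = p)"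

definition incident_NE :: "step list \<Rightarrow> nat \<times> nat \<Rightarrow> bool" where
  "incident_NE P p \<longleftrightarrow> (\<exists>A s B. P = A @ [s] @ B \<and> s \<in> {North, East} \<and>
     (endpoint A = p \<or> endpoint (A @ [s]) = p))"

text \<open>
  \<open>reach_west P u v\<close>: moving west from \<open>(u, u)\<close>, the first point of \<open>P\<close> is \<open>(v, u)\<close>. Every point of
  a path with an integral second coordinate lies on a horizontal step or is a lattice point, so
  looking at lattice points suffices.
\<close>

definition reach_west :: "step list \<Rightarrow> nat \<Rightarrow> nat \<Rightarrow> bool" where
  "reach_west P u v \<longleftrightarrow> v \<le> u \<and> (v, u) \<in> lattice_points P \<and>
     (\<forall>w. v < w \<and> w \<le> u \<longrightarrow> (w, u) \<notin> lattice_points P)"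

text \<open>The bounce path is given by the list \<open>us = [u\<^sub>0, \<dots>, u\<^bsub>k+1\<^esub>]\<close>, where \<open>k \<ge> 1\<close>.\<close>

definition bounce_path :: "step list \<Rightarrow> nat \<times> nat \<Rightarrow> nat list \<Rightarrow> bool" where
  "bounce_path P p us \<longleftrightarrow> (\<exists>k\<ge>1. length us = k + 2 \<and>
     p = (us ! 1, us ! 0) \<and> p \<in> lattice_points P \<and>
     (\<forall>i\<in>{1..k}. reach_west P (us ! i) (us ! (i + 1))) \<and>
     (\<forall>i\<in>{1..<k}. between_diagonals P (us ! (i + 1), us ! i)) \<and>
     incident_NE P (us ! (k + 1), us ! k))"

definition bounce_points :: "nat list \<Rightarrow> (nat \<times> nat) set" where
  "bounce_points us = {(us ! i, us ! i) | i. 1 \<le> i \<and> i + 1 < length us}"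

text \<open>
  The decomposition \<open>P = Us\<^sub>1 \<cdot> s\<^sub>2Vs\<^sub>3 \<cdot> s\<^sub>4W\<close> at \<open>p\<close>: the first part ends at the endpoint
  \<open>(u\<^bsub>k+1\<^esub>, u\<^sub>k)\<close> of the bounce path, the last part starts at \<open>p = (u\<^sub>1, u\<^sub>0)\<close>.
\<close>

definition bounce_decomposition ::
  "step list \<Rightarrow> nat \<times> nat \<Rightarrow> step list \<Rightarrow> step \<Rightarrow> step \<Rightarrow> step list \<Rightarrow> step \<Rightarrow> step \<Rightarrow> step list \<Rightarrow> bool"
where
  "bounce_decomposition P p U s1 s2 V s3 s4 W \<longleftrightarrow>
     P = (U @ [s1]) @ ([s2] @ V @ [s3]) @ ([s4] @ W) \<and>
     (\<exists>us. bounce_path P p us \<and>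
        endpoint (U @ [s1]) = (us ! (length us - 1), us ! (length us - 2)) \<and>
        endpoint ((U @ [s1]) @ ([s2] @ V @ [s3])) = p)"


section \<open>The graph of a path and its orientations\<close>

text \<open>The path as a curve in the plane, and the region between it and the line \<open>y = x\<close>.\<close>

definition to_plane :: "nat \<times> nat \<Rightarrow> real \<times> real" where
  "to_plane p = (real (fst p), real (snd p))"

definition path_curve :: "step list \<Rightarrow> (real \<times> real) set" where
  "path_curve P = \<Union> {closed_segment (to_plane (endpoint A)) (to_plane (endpoint (A @ [s]))) | A s B.
     P = A @ [s] @ B}"

definition path_region :: "step list \<Rightarrow> (real \<times> real) set" where
  "path_region P = {(a, b). a \<le> b \<and> (\<exists>c\<ge>b. (a, c) \<in> path_curve P)}"

definition path_size :: "step list \<Rightarrow> nat" where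
  "path_size P = fst (endpoint P)"

definition vertices :: "step list \<Rightarrow> nat set" where
  "vertices P = {1..path_size P}"

definition nonstrict_edges :: "step list \<Rightarrow> nat set set" where
  "nonstrict_edges P = {{x, y} | x y. 1 \<le> x \<and> x < y \<and> y \<le> path_size P \<and>
     {real x - 1..real x} \<times> {real y - 1..real y} \<subseteq> path_region P}"

definition strict_edges :: "step list \<Rightarrow> nat set set" where
  "strict_edges P = {{x, y} | x y. 1 \<le> x \<and> x < y \<and> y \<le> path_size P \<and>
     (\<exists>A B. P = A @ [Diag] @ B \<and> endpoint A = (x - 1, y - 1))}"

text \<open>A pair \<open>(u, v)\<close> is the directed edge from \<open>u\<close> to \<open>v\<close>.\<close>

definition orientation :: "step list \<Rightarrow> (nat \<times> nat) set \<Rightarrow> bool" where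
  "orientation P \<theta> \<longleftrightarrow>
     (\<forall>(u, v)\<in>\<theta>. {u, v} \<in> nonstrict_edges P \<union> strict_edges P) \<and>
     (\<forall>u v. {u, v} \<in> nonstrict_edges P \<union> strict_edges P \<longrightarrow> ((u, v) \<in> \<theta> \<longleftrightarrow> (v, u) \<notin> \<theta>))"

definition orientations :: "step list \<Rightarrow> (nat \<times> nat) set set" where
  "orientations P = {\<theta>. orientation P \<theta> \<and> (\<forall>u v. u < v \<and> {u, v} \<in> strict_edges P \<longrightarrow> (u, v) \<in> \<theta>)}"

definition ascending_edges :: "step list \<Rightarrow> (nat \<times> nat) set \<Rightarrow> (nat \<times> nat) set" where
  "ascending_edges P \<theta> = {(u, v)\<in>\<theta>. u < v \<and> {u, v} \<in> nonstrict_edges P}"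

definition asc :: "step list \<Rightarrow> (nat \<times> nat) set \<Rightarrow> nat" where
  "asc P \<theta> = card (ascending_edges P \<theta>)"

definition hrv :: "step list \<Rightarrow> (nat \<times> nat) set \<Rightarrow> nat \<Rightarrow> nat" where
  "hrv P \<theta> u =
     Max {v. (u, v) \<in> ({(a, b)\<in>\<theta>. {a, b} \<in> strict_edges P} \<union> ascending_edges P \<theta>)\<^sup>*}"

definition hrv_partition :: "step list \<Rightarrow> (nat \<times> nat) set \<Rightarrow> nat multiset" where
  "hrv_partition P \<theta> = image_mset card (mset_set
     {{w \<in> vertices P. hrv P \<theta> w = hrv P \<theta> u} | u. u \<in> vertices P})"

definition LLTe :: "step list \<Rightarrow> K sym_fun" where
  "LLTe P = (\<Sum>\<theta>\<in>orientations P. (q - 1) ^ asc P \<theta> *\<^sub>K elem_sym_part (hrv_partition P \<theta>))"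

end

theory Submission
  imports Defs "HOL-Combinatorics.Transposition"
begin

text \<open>
  An orientation is determined by its set \<open>T\<close> of ascending edges, so \<open>LLTe P\<close> is the sum over
  \<open>T \<subseteq> N\<close> of \<open>(q - 1) ^ card T\<close> times the elementary function of the classes of the highest
  reachable vertex in the acyclic relation \<open>S \<union> T\<close>, with \<open>N\<close> and \<open>S\<close> the non-strict and strict
  edges. Splitting off one edge of \<open>N\<close> gives the corner relation. For the bounce relation, let \<open>a\<close> be the
  bounce point and \<open>b = a + 1\<close>. The two vertices have the same neighbours except for the edges to
  the vertex \<open>z\<close> on top, to the vertex \<open>v\<close> where the bounce path ends (if \<open>s\<close> is diagonal), and to
  each other. After splitting off these exceptional edges, some of the sums agree because
  transposing \<open>a\<close> and \<open>b\<close> permutes the subsets \<open>T\<close>; the others agree for each \<open>T\<close> separately,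
  since an added edge \<open>x \<rightarrow> y\<close> changes the highest reachable vertices only through that of \<open>y\<close>.
\<close>

section \<open>Orientations as edge sets\<close>

text \<open>This is \<open>hrv\<close> freed from the path: a single relation is the input, so it
  also makes sense for edge sets that come from no path.\<close>

definition reach_max :: "(nat \<times> nat) set \<Rightarrow> nat \<Rightarrow> nat" where
  "reach_max R u = Max (R\<^sup>* `` {u})"

definition level_sets :: "'a set \<Rightarrow> ('a \<Rightarrow> 'b) \<Rightarrow> 'a set set" where
  "level_sets V h = (\<lambda>u. {w \<in> V. h w = h u}) ` V"

definition elem_sym_levels :: "'a set \<Rightarrow> ('a \<Rightarrow> 'b) \<Rightarrow> K sym_fun" where
  "elem_sym_levels V h = elem_sym_part (image_mset card (mset_set (level_sets V h)))"

text \<open>\<open>N\<close> and \<open>S\<close> are arbitrary here, so an edge may move from one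
  to the other even if no path has the resulting graph.\<close>

definition graph_sum :: "nat set \<Rightarrow> (nat \<times> nat) set \<Rightarrow> (nat \<times> nat) set \<Rightarrow> K sym_fun" where
  "graph_sum V N S =
     (\<Sum>T\<in>Pow N. (q - 1) ^ card T *\<^sub>K elem_sym_levels V (reach_max (S \<union> T)))"

section \<open>Highest reachable vertices after adding an edge\<close>

lemma finite_reach:
  assumes "finite R"
  shows "finite (R\<^sup>* `` {u})"
proof (rule finite_subset)
  show "R\<^sup>* `` {u} \<subseteq> insert u (Range R)"
    by (auto elim: rtranclE)
  show "finite (insert u (Range R))"
    using assms by (simp add: finite_Range)
qed

text \<open>A walk through the new edge first reaches \<open>x\<close> by old edges and, after its
  last use of the new edge, continues from \<open>y\<close> by old edges. So whenever
  \<open>u\<close> reaches \<open>x\<close>, its reachable set gains exactly that of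
  \<open>y\<close>.\<close>

lemma reach_max_insert:
  assumes "finite R"
  shows "reach_max (insert (x, y) R) u =
    (if (u, x) \<in> R\<^sup>* then max (reach_max R u) (reach_max R y) else reach_max R u)"
proof -
  have "(insert (x, y) R)\<^sup>* `` {u} = R\<^sup>* `` {u} \<union> (if (u, x) \<in> R\<^sup>* then R\<^sup>* `` {y} else {})"
    by (auto simp: rtrancl_insert)
  moreover have "R\<^sup>* `` {w} \<noteq> {}" for w
    by auto
  ultimately show ?thesis
    using finite_reach[OF assms] by (simp add: reach_max_def Max_Un)
qed

lemma reach_max_antimono:
  assumes "finite R" "(u, w) \<in> R\<^sup>*"
  shows "reach_max R w \<le> reach_max R u"
  unfolding reach_max_def
  using assms by (intro Max_mono finite_reach) (auto intro: rtrancl_trans)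

text \<open>Only vertices that reach \<open>x\<close> are affected, and their old value is at least
  that of \<open>x\<close>. The value of the new target thus matters only through its maximum with
  the value of \<open>x\<close>.\<close>

lemma reach_max_insert_cong:
  assumes "finite R"
    and "max (reach_max R x) (reach_max R y) = max (reach_max R x) (reach_max R z)"
  shows "reach_max (insert (x, y) R) = reach_max (insert (x, z) R)"
proof
  fix u
  show "reach_max (insert (x, y) R) u = reach_max (insert (x, z) R) u"
    using reach_max_antimono[OF assms(1), of u x] assms(2)
    by (auto simp: reach_max_insert[OF assms(1)])
qed

lemma reach_max_insert_redundant:
  assumes "finite R" "reach_max R y \<le> reach_max R x"
  shows "reach_max (insert (x, y) R) = reach_max R"
proof
  fix u
  show "reach_max (insert (x, y) R) u = reach_max R u"
    using reach_max_antimono[OF assms(1), of u x] assms(2)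
    by (auto simp: reach_max_insert[OF assms(1)])
qed

lemma rtrancl_increasing:
  fixes u w :: "'a::order"
  assumes "(u, w) \<in> R\<^sup>*" "R \<subseteq> {(u, w). u < w}"
  shows "u \<le> w"
  using assms by (induction rule: rtrancl_induct) (auto dest: order_trans less_imp_le)

lemma reach_max_insert_above:
  assumes "finite R" "R \<subseteq> {(u, w). u < w}" "x < u"
  shows "reach_max (insert (x, y) R) u = reach_max R u"
  using rtrancl_increasing[OF _ assms(2), of u x] assms(3)
  by (auto simp: reach_max_insert[OF assms(1)])

lemma reach_max_insert_self:
  assumes "finite R"
  shows "reach_max (insert (x, y) R) x = max (reach_max R x) (reach_max R y)"
  by (simp add: reach_max_insert[OF assms])

section \<open>Splitting off an edge, and level sets under relabelling\<close>

lemma sf_scale_zero: "c *\<^sub>K 0 = 0"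
  by transfer simp

lemma sf_scale_sum: "c *\<^sub>K (\<Sum>i\<in>A. f i) = (\<Sum>i\<in>A. c *\<^sub>K f i)"
  by (induction A rule: infinite_finite_induct) (simp_all add: sf_scale_zero sf_scale_algebra(1))

text \<open>Subsets avoiding \<open>e\<close> give the first summand. Those containing
  \<open>e\<close> carry one more factor \<open>q - 1\<close>, and in them \<open>e\<close> acts
  like a strict edge.\<close>

lemma graph_sum_insert:
  assumes "finite N" "e \<notin> N"
  shows "graph_sum V (insert e N) S = graph_sum V N S + (q - 1) *\<^sub>K graph_sum V N (insert e S)"
proof -
  let ?f = "\<lambda>T. (q - 1) ^ card T *\<^sub>K elem_sym_levels V (reach_max (S \<union> T))"
  have "graph_sum V (insert e N) S = sum ?f (Pow N) + sum ?f (insert e ` Pow N)"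
    unfolding graph_sum_def Pow_insert using assms by (intro sum.union_disjoint) auto
  also have "sum ?f (insert e ` Pow N) = (\<Sum>T\<in>Pow N. ?f (insert e T))"
    using assms(2) by (intro sum.reindex_cong[where l = "insert e"]) (auto simp: inj_on_def)
  also have "\<dots> = (\<Sum>T\<in>Pow N. (q - 1) *\<^sub>K (q - 1) ^ card T *\<^sub>K
      elem_sym_levels V (reach_max (insert e S \<union> T)))"
  proof (rule sum.cong)
    fix T assume "T \<in> Pow N"
    then have "e \<notin> T" "finite T"
      using assms finite_subset by auto
    then show "?f (insert e T) =
        (q - 1) *\<^sub>K (q - 1) ^ card T *\<^sub>K elem_sym_levels V (reach_max (insert e S \<union> T))"
      by (simp add: sf_scale_algebra(3))
  qed simp
  finally show ?thesis
    by (simp add: graph_sum_def sf_scale_sum)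
qed

text \<open>The partition records only the sizes of level sets. As \<open>g\<close> separates the
  values of \<open>h\<close>, the bijection \<open>f\<close> carries level sets to level
  sets.\<close>

lemma elem_sym_levels_transport:
  assumes bij: "bij_betw f V V'" and inj: "inj_on g (h ` V)"
    and h': "\<And>u. u \<in> V \<Longrightarrow> h' (f u) = g (h u)"
  shows "elem_sym_levels V' h' = elem_sym_levels V h"
proof -
  have V': "V' = f ` V" and inj_f: "inj_on f V"
    using bij by (auto simp: bij_betw_def)
  have cls: "{w \<in> V'. h' w = h' (f u)} = f ` {w \<in> V. h w = h u}" if "u \<in> V" for u
  proof -
    have "g (h w) = g (h u) \<longleftrightarrow> h w = h u" if "w \<in> V" for w
      using inj that \<open>u \<in> V\<close> by (intro inj_on_eq_iff) auto
    then show ?thesis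
      using that by (auto simp: V' h')
  qed
  have eq: "level_sets V' h' = image f ` level_sets V h"
    unfolding level_sets_def V' image_image using cls by (intro image_cong) (simp_all add: V')
  have sub: "C \<subseteq> V" if "C \<in> level_sets V h" for C
    using that by (auto simp: level_sets_def)
  have "inj_on (image f) (level_sets V h)"
    using inj_f sub by (intro inj_onI) (metis inj_on_image_eq_iff)
  then have "image_mset card (mset_set (level_sets V' h')) =
      image_mset (\<lambda>C. card (f ` C)) (mset_set (level_sets V h))"
    by (simp add: eq image_mset_mset_set[symmetric] multiset.map_comp comp_def)
  also have "\<dots> = image_mset card (mset_set (level_sets V h))"
  proof (rule image_mset_cong)
    fix C assume "C \<in># mset_set (level_sets V h)"
    \<comment> \<open>\<open>mset_set\<close> of an infinite set is empty, so membership in it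
      implies membership in the set in either case.\<close>
    then have "C \<subseteq> V"
      using sub by (metis elem_mset_set empty_iff mset_set.infinite set_mset_empty)
    then show "card (f ` C) = card C"
      using inj_f by (meson card_image inj_on_subset)
  qed
  finally show ?thesis
    by (simp add: elem_sym_levels_def)
qed

lemma elem_sym_levels_cong:
  "(\<And>u. u \<in> V \<Longrightarrow> h u = h' u) \<Longrightarrow> elem_sym_levels V h = elem_sym_levels V h'"
  by (rule elem_sym_levels_transport[where f = id and g = id]) auto

text \<open>No class meets both \<open>V\<close> and \<open>W\<close>, since no value is shared; so
  the multiset of class sizes is a sum and its elementary function a product.\<close>

lemma elem_sym_levels_Un:
  assumes "finite V" "finite W" "V \<inter> W = {}" "h ` V \<inter> h ` W = {}"
  shows "elem_sym_levels (V \<union> W) h = elem_sym_levels V h * elem_sym_levels W h"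
proof -
  have "{w \<in> V \<union> W. h w = h u} = {w \<in> V. h w = h u}" if "u \<in> V" for u
    using assms(4) that by (auto simp: disjoint_iff)
  moreover have "{w \<in> V \<union> W. h w = h u} = {w \<in> W. h w = h u}" if "u \<in> W" for u
    using assms(4) that by (auto simp: disjoint_iff)
  ultimately have "level_sets (V \<union> W) h = level_sets V h \<union> level_sets W h"
    unfolding level_sets_def image_Un by (intro arg_cong2[where f = "(\<union>)"] image_cong) auto
  moreover have "level_sets V h \<inter> level_sets W h = {}"
    using assms(3) unfolding level_sets_def by fastforce
  moreover have "finite (level_sets V h)" "finite (level_sets W h)"
    using assms(1,2) by (simp_all add: level_sets_def)
  ultimately show ?thesis
    by (simp add: elem_sym_levels_def elem_sym_part_def mset_set_Union)
qed

lemma rtrancl_image_map_prod: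
  assumes "inj f"
  shows "(map_prod f f ` R)\<^sup>* `` {f u} = f ` (R\<^sup>* `` {u})"
proof (intro equalityI subsetI)
  fix w assume "w \<in> (map_prod f f ` R)\<^sup>* `` {f u}"
  then have "(f u, w) \<in> (map_prod f f ` R)\<^sup>*"
    by simp
  then show "w \<in> f ` (R\<^sup>* `` {u})"
  proof (induction rule: rtrancl_induct)
    case (step y z)
    then show ?case
      using assms by (force dest: injD intro: rtrancl_into_rtrancl)
  qed auto
next
  fix w assume "w \<in> f ` (R\<^sup>* `` {u})"
  then obtain y where y: "(u, y) \<in> R\<^sup>*" "w = f y"
    by auto
  from y(1) have "(f u, f y) \<in> (map_prod f f ` R)\<^sup>*"
  proof (induction rule: rtrancl_induct)
    case (step y z)
    then have "(f y, f z) \<in> map_prod f f ` R"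
      by force
    with step.IH show ?case
      by (rule rtrancl_into_rtrancl)
  qed simp
  with y(2) show "w \<in> (map_prod f f ` R)\<^sup>* `` {f u}"
    by simp
qed

section \<open>Exchanging two consecutive twin vertices\<close>

abbreviation adj_swap :: "nat \<Rightarrow> nat \<Rightarrow> nat" where
  "adj_swap a \<equiv> Transposition.transpose a (Suc a)"

text \<open>The transposition reverses the order of no pair other than \<open>a\<close> and
  \<open>Suc a\<close>, so a maximum goes wrong only if it is \<open>Suc a\<close> while
  \<open>a\<close> is present too.\<close>

lemma Max_transpose_Suc:
  fixes a :: nat
  assumes "finite X" "X \<noteq> {}" "\<not> (a \<in> X \<and> Max X = Suc a)"
  shows "Max (adj_swap a ` X) = adj_swap a (Max X)"
proof (rule Max_eqI)
  fix y assume "y \<in> adj_swap a ` X"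
  then obtain w where w: "w \<in> X" "y = adj_swap a w"
    by auto
  then have "w \<le> Max X"
    using assms by simp
  then show "y \<le> adj_swap a (Max X)"
    using assms(3) w by (auto simp: Transposition.transpose_def)
qed (use assms in auto)

text \<open>
  Transposing \<open>a\<close> and \<open>Suc a\<close> commutes with taking the maximum of a reachable set unless this set
  contains \<open>a\<close> and has maximum \<open>Suc a\<close>, which an edge from either vertex to a higher one excludes.
\<close>

lemma reach_max_transpose_Suc:
  assumes fin: "finite R" and "Suc a < z" and edge: "(a, z) \<in> R \<or> (Suc a, z) \<in> R"
  shows "reach_max (map_prod (adj_swap a) (adj_swap a) ` R)
           (adj_swap a u) = adj_swap a (reach_max R u)"
proof -
  let ?X = "R\<^sup>* `` {u}"
  have "\<not> (a \<in> ?X \<and> Max ?X = Suc a)"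
  proof
    assume *: "a \<in> ?X \<and> Max ?X = Suc a"
    moreover have "?X \<noteq> {}"
      by auto
    ultimately have "Suc a \<in> ?X"
      using Max_in[OF finite_reach[OF fin], of u] by metis
    \<comment> \<open>Both \<open>a\<close> and \<open>Suc a\<close> are reachable, so either form
      of \<open>edge\<close> leads on to \<open>z\<close>, beyond the supposed maximum.\<close>
    with * edge have "z \<in> ?X"
      by (auto intro: rtrancl_into_rtrancl)
    then show False
      using * \<open>Suc a < z\<close> Max_ge[OF finite_reach[OF fin], of z u] by simp
  qed
  moreover have "?X \<noteq> {}"
    by auto
  ultimately show ?thesis
    unfolding reach_max_def by (simp add: rtrancl_image_map_prod Max_transpose_Suc finite_reach[OF fin])
qed

text \<open>Taking images under the transposition permutes \<open>Pow N\<close> and keeps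
  cardinalities. The edge to \<open>z\<close> lies in \<open>S\<close>, hence in every relation of
  the sum, so the highest reachable vertices are transposed along with the labels.\<close>

lemma graph_sum_transpose_Suc:
  fixes a :: nat
  defines "\<sigma> \<equiv> adj_swap a"
  assumes "finite N" "finite S" "\<sigma> ` V = V" "map_prod \<sigma> \<sigma> ` N = N"
    and "Suc a < z" "(a, z) \<in> S \<or> (Suc a, z) \<in> S"
  shows "graph_sum V N (map_prod \<sigma> \<sigma> ` S) = graph_sum V N S"
proof -
  let ?s = "map_prod \<sigma> \<sigma>"
  have inv: "?s (?s e) = e" for e
    by (cases e) (simp add: \<sigma>_def)
  then have "inj ?s"
    by (rule inj_on_inverseI)
  have img: "?s ` T \<in> Pow N" "?s ` ?s ` T = T" if "T \<in> Pow N" for T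
    using that assms(5) inv by (auto simp: image_image)
  show ?thesis
    unfolding graph_sum_def
  proof (rule sum.reindex_bij_witness[where i = "image ?s" and j = "image ?s"])
    fix T assume T: "T \<in> Pow N"
    then have "finite (S \<union> ?s ` T)"
      using assms(2,3) img finite_subset[of T N] by auto
    then have hr: "reach_max (?s ` (S \<union> ?s ` T)) (\<sigma> u) = \<sigma> (reach_max (S \<union> ?s ` T) u)" for u
      unfolding \<sigma>_def using assms(6,7) by (intro reach_max_transpose_Suc[of _ a z]) auto
    have "elem_sym_levels V (reach_max (?s ` (S \<union> ?s ` T))) =
        elem_sym_levels V (reach_max (S \<union> ?s ` T))"
      by (rule elem_sym_levels_transport[where f = \<sigma> and g = \<sigma>])
         (use hr assms(4) in \<open>auto simp: bij_betw_def \<sigma>_def intro: inj_on_subset[OF inj_transpose]\<close>)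
    moreover have "card (?s ` T) = card T"
      using \<open>inj ?s\<close> by (metis card_image inj_on_subset subset_UNIV)
    ultimately show "(q - 1) ^ card (?s ` T) *\<^sub>K elem_sym_levels V (reach_max (S \<union> ?s ` T)) =
        (q - 1) ^ card T *\<^sub>K elem_sym_levels V (reach_max (?s ` S \<union> T))"
      using img[OF T] by (simp add: image_Un)
  qed (use img in auto)
qed

text \<open>The sides agree term by term, in an order decided by the value of \<open>b\<close>. If
  it is at most that of \<open>a\<close> or of \<open>z\<close>, the first term equals the fourth
  and the second the third; otherwise the first equals the third and the second the fourth.\<close>

lemma reach_max_exchange:
  assumes fin: "finite R" and inc: "R \<subseteq> {(u, w). u < w}" and "a < b" "b < z"
  shows "elem_sym_levels V (reach_max ({(a, b), (a, z)} \<union> R)) +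
           elem_sym_levels V (reach_max ({(a, z), (b, z)} \<union> R)) =
         elem_sym_levels V (reach_max ({(a, b), (b, z)} \<union> R)) +
           elem_sym_levels V (reach_max ({(a, z)} \<union> R))"
proof -
  let ?h = "reach_max R"
  have "a < z"
    using \<open>a < b\<close> \<open>b < z\<close> by simp
  note val = fin inc \<open>a < b\<close> \<open>b < z\<close> \<open>a < z\<close> reach_max_insert_above reach_max_insert_self
  show ?thesis
  proof (cases "?h b \<le> max (?h a) (?h z)")
    case True
    \<comment> \<open>The edge to \<open>z\<close> has already raised the value of \<open>a\<close>
      to at least that of \<open>b\<close>.\<close>
    have "reach_max (insert (a, b) (insert (a, z) R)) = reach_max (insert (a, z) R)"
      using True by (intro reach_max_insert_redundant) (simp_all add: val)
    moreover have "reach_max (insert (a, z) (insert (b, z) R)) = reach_max (insert (a, b) (insert (b, z) R))"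
      using True by (intro reach_max_insert_cong) (auto simp add: val reach_max_insert)
    ultimately show ?thesis
      by (simp add: insert_commute add.commute)
  next
    case False
    have "reach_max (insert (a, z) (insert (a, b) R)) = reach_max (insert (a, b) R)"
      using False by (intro reach_max_insert_redundant) (auto simp add: val)
    moreover have "reach_max (insert (b, z) (insert (a, b) R)) = reach_max (insert (a, b) R)"
      using False by (intro reach_max_insert_redundant) (auto simp add: val)
    moreover have "reach_max (insert (b, z) (insert (a, z) R)) = reach_max (insert (a, z) R)"
      using False by (intro reach_max_insert_redundant) (auto simp add: val)
    ultimately show ?thesis
      by (simp add: insert_commute)
  qed
qed

text \<open>The terms match in the same way as in \<open>reach_max_exchange\<close>. If the value of
  \<open>b\<close> exceeds those of \<open>a\<close> and \<open>z\<close>, the edge from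
  \<open>a\<close> to \<open>b\<close> gives both the same value, so in its presence
  \<open>v\<close> may be joined to either.\<close>

lemma reach_max_exchange_below:
  assumes fin: "finite R" and inc: "R \<subseteq> {(u, w). u < w}" and "v < a" "a < b" "b < z"
  shows "elem_sym_levels V (reach_max ({(v, a), (a, b), (a, z)} \<union> R)) +
           elem_sym_levels V (reach_max ({(v, b), (a, z), (b, z)} \<union> R)) =
         elem_sym_levels V (reach_max ({(v, b), (a, b), (b, z)} \<union> R)) +
           elem_sym_levels V (reach_max ({(v, a), (v, b), (a, z)} \<union> R))"
proof -
  let ?h = "reach_max R"
  have "a < z" "v < b" "v < z"
    using assms by simp_all
  note val = fin inc assms(3-5) this reach_max_insert_above reach_max_insert_self
  show ?thesis
  proof (cases "?h b \<le> max (?h a) (?h z)")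
    case True
    have "reach_max (insert (a, b) (insert (v, a) (insert (a, z) R))) =
        reach_max (insert (v, a) (insert (a, z) R))"
      using True by (intro reach_max_insert_redundant) (simp_all add: val)
    moreover have "reach_max (insert (v, b) (insert (v, a) (insert (a, z) R))) =
        reach_max (insert (v, a) (insert (a, z) R))"
      using True by (intro reach_max_insert_redundant) (auto simp add: val)
    moreover have "reach_max (insert (a, z) (insert (v, b) (insert (b, z) R))) =
        reach_max (insert (a, b) (insert (v, b) (insert (b, z) R)))"
      using True by (intro reach_max_insert_cong) (auto simp add: val reach_max_insert)
    ultimately show ?thesis
      by (simp add: insert_commute add.commute)
  next
    case False
    have "reach_max (insert (a, z) (insert (v, a) (insert (a, b) R))) =
        reach_max (insert (v, a) (insert (a, b) R))"
      using False by (intro reach_max_insert_redundant) (auto simp add: val)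
    moreover have "reach_max (insert (b, z) (insert (v, b) (insert (a, b) R))) =
        reach_max (insert (v, b) (insert (a, b) R))"
      using False by (intro reach_max_insert_redundant) (auto simp add: val)
    moreover have "reach_max (insert (v, a) (insert (a, b) R)) =
        reach_max (insert (v, b) (insert (a, b) R))"
      using False by (intro reach_max_insert_cong) (auto simp add: val)
    moreover have "reach_max (insert (b, z) (insert (v, b) (insert (a, z) R))) =
        reach_max (insert (v, b) (insert (a, z) R))"
      using False by (intro reach_max_insert_redundant) (auto simp add: val)
    moreover have "reach_max (insert (v, a) (insert (v, b) (insert (a, z) R))) =
        reach_max (insert (v, b) (insert (a, z) R))"
      using False by (intro reach_max_insert_redundant) (auto simp add: val)
    ultimately show ?thesis
      by (simp add: insert_commute)
  qed
qed

lemma graph_sum_add_cong: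
  assumes "\<And>T. T \<subseteq> N \<Longrightarrow> elem_sym_levels V (reach_max (S1 \<union> T)) + elem_sym_levels V (reach_max (S2 \<union> T)) =
    elem_sym_levels V (reach_max (S3 \<union> T)) + elem_sym_levels V (reach_max (S4 \<union> T))"
  shows "graph_sum V N S1 + graph_sum V N S2 = graph_sum V N S3 + graph_sum V N S4"
proof -
  have "(q - 1) ^ card T *\<^sub>K elem_sym_levels V (reach_max (S1 \<union> T)) +
      (q - 1) ^ card T *\<^sub>K elem_sym_levels V (reach_max (S2 \<union> T)) =
      (q - 1) ^ card T *\<^sub>K elem_sym_levels V (reach_max (S3 \<union> T)) +
      (q - 1) ^ card T *\<^sub>K elem_sym_levels V (reach_max (S4 \<union> T))" if "T \<in> Pow N" for T
    using assms that by (simp flip: sf_scale_algebra(1))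
  then show ?thesis
    unfolding graph_sum_def sum.distrib[symmetric] by (intro sum.cong) auto
qed

lemma graph_sum_reach_cong:
  assumes "\<And>T. T \<subseteq> N \<Longrightarrow> reach_max (S1 \<union> T) = reach_max (S2 \<union> T)"
  shows "graph_sum V N S1 = graph_sum V N S2"
  unfolding graph_sum_def using assms by (intro sum.cong) auto

lemma q_scale: "q *\<^sub>K f = f + (q - 1) *\<^sub>K f"
  using sf_scale_algebra(2)[of 1 "q - 1" f] by (simp add: sf_scale_algebra(4))

text \<open>The part shared by the two graphs of the bounce relation once the exceptional edges are
  removed. Invariance under the transposition expresses that \<open>a\<close> and \<open>b\<close>
  have the same neighbours there.\<close>

locale twin_vertices =
  fixes N S :: "(nat \<times> nat) set" and a b z :: nat and V :: "nat set"
  assumes fin: "finite N" "finite S"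
    and inc: "N \<subseteq> {(u, w). u < w}" "S \<subseteq> {(u, w). u < w}"
    and b: "b = Suc a" and bz: "b < z"
    and V: "adj_swap a ` V = V"
    and N: "map_prod (adj_swap a) (adj_swap a) ` N = N"
    and S: "map_prod (adj_swap a) (adj_swap a) ` S = S"
begin

lemma notin: "(a, b) \<notin> N"
proof
  assume "(a, b) \<in> N"
  then have "(b, a) \<in> N"
    using N b by force
  then show False
    using inc b by auto
qed

lemma fin_inc:
  assumes "T \<subseteq> N"
  shows "finite (S \<union> T)" "S \<union> T \<subseteq> {(u, w). u < w}"
  using assms inc fin finite_subset[of T N] by auto

text \<open>Both sides are expanded over the exceptional edges, with \<open>q\<close> written as
  \<open>1 + (q - 1)\<close>, and collected by the number of factors \<open>q - 1\<close> split off.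
  The terms with none agree by transposition, those with one by the exchange identity, those with
  two by redundancy of an edge.\<close>

lemma graph_sum_exchange:
  assumes "(b, z) \<notin> N"
  shows "graph_sum V ({(a, b), (b, z)} \<union> N) ({(a, z)} \<union> S) =
    q *\<^sub>K graph_sum V ({(a, b)} \<union> N) ({(b, z)} \<union> S)"
proof -
  let ?G = "\<lambda>X. graph_sum V N (X \<union> S)"
  let ?p = "\<lambda>x. (q - 1) *\<^sub>K x"
  have L: "graph_sum V ({(a, b), (b, z)} \<union> N) ({(a, z)} \<union> S) =
      ?G {(a, z)} + ?p (?G {(a, z), (b, z)}) + ?p (?G {(a, b), (a, z)} + ?p (?G {(a, b), (a, z), (b, z)}))"
    using assms notin fin bz b by (simp add: graph_sum_insert insert_commute)
  have R: "graph_sum V ({(a, b)} \<union> N) ({(b, z)} \<union> S) = ?G {(b, z)} + ?p (?G {(a, b), (b, z)})"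
    using notin fin by (simp add: graph_sum_insert)
  have swap: "?G {(b, z)} = ?G {(a, z)}"
    using graph_sum_transpose_Suc[of N "insert (a, z) S" a V z] fin V N S b bz by simp
  have exch: "?G {(a, b), (a, z)} + ?G {(a, z), (b, z)} = ?G {(a, b), (b, z)} + ?G {(a, z)}"
  proof (rule graph_sum_add_cong)
    fix T assume "T \<subseteq> N"
    from reach_max_exchange[OF fin_inc[OF this], of a b z V] b bz
    show "elem_sym_levels V (reach_max ({(a, b), (a, z)} \<union> S \<union> T)) +
        elem_sym_levels V (reach_max ({(a, z), (b, z)} \<union> S \<union> T)) =
      elem_sym_levels V (reach_max ({(a, b), (b, z)} \<union> S \<union> T)) +
        elem_sym_levels V (reach_max ({(a, z)} \<union> S \<union> T))"
      by (simp only: Un_assoc lessI)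
  qed
  \<comment> \<open>The walk from \<open>a\<close> through \<open>b\<close> to \<open>z\<close>
    makes the edge from \<open>a\<close> to \<open>z\<close> redundant.\<close>
  have "reach_max (insert (a, z) (insert (a, b) (insert (b, z) (S \<union> T)))) =
      reach_max (insert (a, b) (insert (b, z) (S \<union> T)))" if "T \<subseteq> N" for T
    using fin_inc[OF that] b bz
    by (intro reach_max_insert_redundant) (auto simp: reach_max_insert_above reach_max_insert_self)
  then have red: "?G {(a, b), (a, z), (b, z)} = ?G {(a, b), (b, z)}"
    by (intro graph_sum_reach_cong) (simp add: insert_commute)
  have "?p (?G {(a, b), (a, z)}) + ?p (?G {(a, z), (b, z)}) = ?p (?G {(a, b), (b, z)}) + ?p (?G {(a, z)})"
    using exch by (simp flip: sf_scale_algebra(1))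
  then show ?thesis
    unfolding L R swap red q_scale sf_scale_algebra(1) by (simp add: algebra_simps)
qed

text \<open>Each side has two optional exceptional edges, so no factor \<open>q\<close> arises.
  Among the terms with one factor \<open>q - 1\<close>, those without \<open>(a, b)\<close> are
  transposed to fit the exchange identity; transposing the others would reverse that edge.\<close>

lemma graph_sum_exchange_below:
  assumes "(b, z) \<notin> N" "(v, a) \<notin> N" "v < a"
  shows "graph_sum V ({(a, b), (b, z)} \<union> N) ({(v, a), (a, z)} \<union> S) =
    graph_sum V ({(v, a), (a, b)} \<union> N) ({(v, b), (b, z)} \<union> S)"
proof -
  let ?G = "\<lambda>X. graph_sum V N (X \<union> S)"
  let ?p = "\<lambda>x. (q - 1) *\<^sub>K x"
  have L: "graph_sum V ({(a, b), (b, z)} \<union> N) ({(v, a), (a, z)} \<union> S) =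
      ?G {(v, a), (a, z)} + ?p (?G {(v, a), (a, z), (b, z)}) +
      ?p (?G {(v, a), (a, b), (a, z)} + ?p (?G {(v, a), (a, b), (a, z), (b, z)}))"
    using assms notin fin bz b by (simp add: graph_sum_insert insert_commute)
  have R: "graph_sum V ({(v, a), (a, b)} \<union> N) ({(v, b), (b, z)} \<union> S) =
      ?G {(v, b), (b, z)} + ?p (?G {(v, b), (a, b), (b, z)}) +
      ?p (?G {(v, a), (v, b), (b, z)} + ?p (?G {(v, a), (v, b), (a, b), (b, z)}))"
    using assms notin fin b by (simp add: graph_sum_insert insert_commute)
  have swap0: "?G {(v, b), (b, z)} = ?G {(v, a), (a, z)}"
    using graph_sum_transpose_Suc[of N "{(v, a), (a, z)} \<union> S" a V z] fin V N S b bz \<open>v < a\<close>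
    by simp
  have swap1: "?G {(v, a), (a, z), (b, z)} = ?G {(v, b), (a, z), (b, z)}"
    using graph_sum_transpose_Suc[of N "{(v, b), (a, z), (b, z)} \<union> S" a V z] fin V N S b bz \<open>v < a\<close>
    by (simp add: insert_commute)
  have swap2: "?G {(v, a), (v, b), (b, z)} = ?G {(v, a), (v, b), (a, z)}"
    using graph_sum_transpose_Suc[of N "{(v, a), (v, b), (a, z)} \<union> S" a V z] fin V N S b bz \<open>v < a\<close>
    by (simp add: insert_commute)
  have exch: "?G {(v, a), (a, b), (a, z)} + ?G {(v, b), (a, z), (b, z)} =
      ?G {(v, b), (a, b), (b, z)} + ?G {(v, a), (v, b), (a, z)}"
  proof (rule graph_sum_add_cong)
    fix T assume "T \<subseteq> N"
    from reach_max_exchange_below[OF fin_inc[OF this], of v a b z V] b bz \<open>v < a\<close>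
    show "elem_sym_levels V (reach_max ({(v, a), (a, b), (a, z)} \<union> S \<union> T)) +
        elem_sym_levels V (reach_max ({(v, b), (a, z), (b, z)} \<union> S \<union> T)) =
      elem_sym_levels V (reach_max ({(v, b), (a, b), (b, z)} \<union> S \<union> T)) +
        elem_sym_levels V (reach_max ({(v, a), (v, b), (a, z)} \<union> S \<union> T))"
      by (simp only: Un_assoc lessI)
  qed
  \<comment> \<open>With all of \<open>(v, a)\<close>, \<open>(a, b)\<close>, \<open>(b, z)\<close>
    present, \<open>z\<close> is reached from \<open>a\<close>, and \<open>b\<close> from
    \<open>v\<close>, without the direct edges.\<close>
  have "reach_max (insert (a, z) (insert (v, a) (insert (a, b) (insert (b, z) (S \<union> T))))) =
      reach_max (insert (v, a) (insert (a, b) (insert (b, z) (S \<union> T))))"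
    and "reach_max (insert (v, b) (insert (v, a) (insert (a, b) (insert (b, z) (S \<union> T))))) =
      reach_max (insert (v, a) (insert (a, b) (insert (b, z) (S \<union> T))))" if "T \<subseteq> N" for T
    using fin_inc[OF that] b bz \<open>v < a\<close>
    by (intro reach_max_insert_redundant;
        auto simp: reach_max_insert_above reach_max_insert_self)+
  then have red: "?G {(v, a), (a, b), (a, z), (b, z)} = ?G {(v, a), (v, b), (a, b), (b, z)}"
    by (intro graph_sum_reach_cong) (simp add: insert_commute)
  have "?p (?G {(v, a), (a, b), (a, z)}) + ?p (?G {(v, b), (a, z), (b, z)}) =
      ?p (?G {(v, b), (a, b), (b, z)}) + ?p (?G {(v, a), (v, b), (a, z)})"
    using exch by (simp flip: sf_scale_algebra(1))
  then show ?thesis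
    unfolding L R swap0 swap1 swap2 red sf_scale_algebra(1) by (simp add: algebra_simps)
qed

end

section \<open>Graphs of Schroeder paths\<close>

lemma endpoint_Nil [simp]: "endpoint [] = 0"
  by (simp add: endpoint_def)

lemma endpoint_Cons [simp]: "endpoint (s # P) = step_vec s + endpoint P"
  by (simp add: endpoint_def)

lemma endpoint_append [simp]: "endpoint (P @ Q) = endpoint P + endpoint Q"
  by (simp add: endpoint_def)

definition diag_starts :: "step list \<Rightarrow> (nat \<times> nat) set" where
  "diag_starts P = {endpoint A | A B. P = A @ [Diag] @ B}"

lemma lattice_points_Nil [simp]: "lattice_points [] = {0}"
  by (simp add: lattice_points_def)

lemma lattice_points_Cons [simp]:
  "lattice_points (s # P) = insert 0 ((+) (step_vec s) ` lattice_points P)"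
proof (intro equalityI subsetI)
  fix r assume "r \<in> lattice_points (s # P)"
  then obtain A B where "r = endpoint A" "s # P = A @ B"
    by (auto simp: lattice_points_def)
  then show "r \<in> insert 0 ((+) (step_vec s) ` lattice_points P)"
    by (cases A) (auto simp: lattice_points_def)
next
  fix r assume "r \<in> insert 0 ((+) (step_vec s) ` lattice_points P)"
  then consider "r = endpoint []" | A B where "r = endpoint (s # A)" "P = A @ B"
    by (auto simp: lattice_points_def)
  then show "r \<in> lattice_points (s # P)"
  proof cases
    case 1
    then show ?thesis
      unfolding lattice_points_def by blast
  next
    case 2
    then have "s # P = (s # A) @ B"
      by simp
    with 2 show ?thesis
      unfolding lattice_points_def by blast
  qed
qed

lemma zero_in_lattice_points [simp]: "0 \<in> lattice_points P"
  by (cases P) auto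

lemma lattice_points_append [simp]:
  "lattice_points (P @ Q) = lattice_points P \<union> (+) (endpoint P) ` lattice_points Q"
proof (induction P)
  case Nil
  then show ?case
    by (auto simp: image_iff)
qed (simp add: image_Un image_image add.assoc)

lemma diag_starts_Nil [simp]: "diag_starts [] = {}"
  by (simp add: diag_starts_def)

lemma diag_starts_Cons [simp]:
  "diag_starts (s # P) = (if s = Diag then {0} else {}) \<union> (+) (step_vec s) ` diag_starts P"
proof (intro equalityI subsetI)
  fix r assume "r \<in> diag_starts (s # P)"
  then obtain A B where "r = endpoint A" "s # P = A @ [Diag] @ B"
    by (auto simp: diag_starts_def)
  then show "r \<in> (if s = Diag then {0} else {}) \<union> (+) (step_vec s) ` diag_starts P"
    by (cases A) (auto simp: diag_starts_def)
next
  fix r assume "r \<in> (if s = Diag then {0} else {}) \<union> (+) (step_vec s) ` diag_starts P"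
  then consider "s = Diag" "r = endpoint []" | A B where "r = endpoint (s # A)" "P = A @ [Diag] @ B"
    by (auto simp: diag_starts_def split: if_splits)
  then show "r \<in> diag_starts (s # P)"
  proof cases
    case 1
    then have "s # P = [] @ [Diag] @ P"
      by simp
    with 1 show ?thesis
      unfolding diag_starts_def by blast
  next
    case 2
    then have "s # P = (s # A) @ [Diag] @ B"
      by simp
    with 2 show ?thesis
      unfolding diag_starts_def by blast
  qed
qed

lemma diag_starts_append [simp]:
  "diag_starts (P @ Q) = diag_starts P \<union> (+) (endpoint P) ` diag_starts Q"
proof (induction P)
  case Nil
  then show ?case
    by simp
qed (simp add: image_Un image_image add.assoc)

lemma lattice_points_le:
  "r \<in> lattice_points P \<Longrightarrow> fst r \<le> fst (endpoint P) \<and> snd r \<le> snd (endpoint P)"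
  by (auto simp: lattice_points_def)

lemma diag_starts_le:
  "r \<in> diag_starts P \<Longrightarrow> fst r < fst (endpoint P) \<and> snd r < snd (endpoint P)"
  by (auto simp: diag_starts_def)

lemma lattice_points_split:
  assumes "P = A @ [s] @ B" "r \<in> lattice_points P"
  shows "fst r \<le> fst (endpoint A) \<and> snd r \<le> snd (endpoint A) \<or>
    fst (endpoint (A @ [s])) \<le> fst r \<and> snd (endpoint (A @ [s])) \<le> snd r"
  using assms lattice_points_le[of r A] by (auto simp: add.assoc)

lemma endpoint_count:
  "endpoint A = (count_list A East + count_list A Diag, count_list A North + count_list A Diag)"
proof (induction A)
  case (Cons s A)
  then show ?case by (cases s) auto
qed (simp add: zero_prod_def)

text \<open>The starting point is an argument so that the condition splits along concatenations. A
  diagonal step raises both coordinates, so comparing coordinates amounts to comparing the numbers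
  of north and east steps.\<close>

fun steps_above :: "nat \<times> nat \<Rightarrow> step list \<Rightarrow> bool" where
  "steps_above p [] \<longleftrightarrow> True"
| "steps_above p (s # P) \<longleftrightarrow> (s \<noteq> North \<longrightarrow> fst p < snd p) \<and> steps_above (p + step_vec s) P"

lemma steps_above_append [simp]:
  "steps_above p (P @ Q) \<longleftrightarrow> steps_above p P \<and> steps_above (p + endpoint P) Q"
  by (induction P arbitrary: p) (auto simp: add.assoc)

lemma steps_above_iff:
  "steps_above p P \<longleftrightarrow>
    (\<forall>A s B. P = A @ [s] @ B \<and> s \<in> {East, Diag} \<longrightarrow> fst (p + endpoint A) < snd (p + endpoint A))"
proof
  assume "steps_above p P"
  then show "\<forall>A s B. P = A @ [s] @ B \<and> s \<in> {East, Diag} \<longrightarrow> fst (p + endpoint A) < snd (p + endpoint A)"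
    by auto
next
  assume "\<forall>A s B. P = A @ [s] @ B \<and> s \<in> {East, Diag} \<longrightarrow> fst (p + endpoint A) < snd (p + endpoint A)"
  then show "steps_above p P"
  proof (induction P rule: rev_induct)
    case (snoc t P)
    have "steps_above p P"
    proof (intro snoc.IH allI impI)
      fix A s B assume "P = A @ [s] @ B \<and> s \<in> {East, Diag}"
      then have "P @ [t] = A @ [s] @ (B @ [t]) \<and> s \<in> {East, Diag}"
        by simp
      then show "fst (p + endpoint A) < snd (p + endpoint A)"
        using snoc.prems by blast
    qed
    moreover have "fst (p + endpoint P) < snd (p + endpoint P)" if "t \<in> {East, Diag}"
      using snoc.prems[rule_format, of P t "[]"] that by simp
    ultimately show ?case
      by (cases t) auto
  qed simp
qed

lemma schroeder_path_iff:
  "schroeder_path n P \<longleftrightarrow> endpoint P = (n, n) \<and> steps_above 0 P"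
  unfolding schroeder_path_def steps_above_iff
  by (simp add: endpoint_count)

lemma SCH_iff: "P \<in> SCH \<longleftrightarrow> (\<exists>n. endpoint P = (n, n) \<and> steps_above 0 P)"
  by (simp add: SCH_def schroeder_path_iff)

lemma lattice_points_above:
  assumes "steps_above p P" "fst p \<le> snd p" "r \<in> lattice_points P"
  shows "fst (p + r) \<le> snd (p + r)"
  using assms
proof (induction P arbitrary: p r)
  case (Cons s P)
  have *: "fst (p + step_vec s) \<le> snd (p + step_vec s)"
    using Cons.prems(1,2) by (cases s) auto
  from Cons.prems(3) consider "r = 0" | r' where "r = step_vec s + r'" "r' \<in> lattice_points P"
    by auto
  then show ?case
    using Cons.IH[of "p + step_vec s"] Cons.prems(1,2) * by cases (simp_all add: add.assoc)
qed simp

lemma diag_starts_above: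
  assumes "steps_above p P" "r \<in> diag_starts P"
  shows "fst (p + r) < snd (p + r)"
  using assms by (auto simp: diag_starts_def)

section \<open>Edges as ordered pairs read off from lattice points\<close>

definition nonstrict_pairs :: "step list \<Rightarrow> (nat \<times> nat) set" where
  "nonstrict_pairs P = {(x, y). 1 \<le> x \<and> x < y \<and> y \<le> path_size P \<and>
     (\<exists>c\<ge>y. (x - 1, c) \<in> lattice_points P)}"

definition strict_pairs :: "step list \<Rightarrow> (nat \<times> nat) set" where
  "strict_pairs P = (\<lambda>(x, y). (Suc x, Suc y)) ` diag_starts P"

lemma closed_segment_step:
  "(a, c) \<in> closed_segment (to_plane p) (to_plane (p + step_vec s)) \<longleftrightarrow>
    (\<exists>t. 0 \<le> t \<and> t \<le> 1 \<and> a = real (fst p) + t * real (fst (step_vec s)) \<and>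
      c = real (snd p) + t * real (snd (step_vec s)))"
  by (cases s) (auto simp: closed_segment_def to_plane_def algebra_simps)

lemma path_curve_iff:
  "(a, c) \<in> path_curve P \<longleftrightarrow>
    (\<exists>A s B. P = A @ [s] @ B \<and>
      (a, c) \<in> closed_segment (to_plane (endpoint A)) (to_plane (endpoint A + step_vec s)))"
  unfolding path_curve_def by (auto)

text \<open>The walk along \<open>B\<close> stops at the first non-vertical step whose horizontal
  range covers \<open>a\<close>; the strict inequality guarantees that there is one, and the curve
  never descends on the way.\<close>

lemma path_curve_reaches:
  assumes "fst (endpoint A) < fst (endpoint (A @ B))"
    and "real (fst (endpoint A)) \<le> a" "a \<le> real (fst (endpoint (A @ B)))"
  shows "\<exists>c\<ge>real (snd (endpoint A)). (a, c) \<in> path_curve (A @ B)"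
  using assms
proof (induction B arbitrary: A)
  case (Cons s B)
  show ?case
  proof (cases "s \<noteq> North \<and> a \<le> real (fst (endpoint A)) + 1")
    case True
    let ?t = "a - real (fst (endpoint A))"
    let ?c = "real (snd (endpoint A)) + ?t * real (snd (step_vec s))"
    have t: "0 \<le> ?t" "?t \<le> 1" "real (fst (step_vec s)) = 1"
      using True Cons.prems(2) by (simp_all, cases s, simp_all)
    then have "(a, ?c) \<in> closed_segment (to_plane (endpoint A)) (to_plane (endpoint A + step_vec s))"
      unfolding closed_segment_step by (intro exI[of _ ?t]) simp
    moreover have "real (snd (endpoint A)) \<le> ?c"
      using t by simp
    moreover have "A @ s # B = A @ [s] @ B"
      by simp
    ultimately show ?thesis
      unfolding path_curve_iff by blast
  next
    case False
    have "\<exists>c\<ge>real (snd (endpoint (A @ [s]))). (a, c) \<in> path_curve ((A @ [s]) @ B)"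
      using Cons.prems False by (intro Cons.IH) (cases s; auto simp: add.assoc)+
    then obtain c where "real (snd (endpoint (A @ [s]))) \<le> c" "(a, c) \<in> path_curve (A @ s # B)"
      by auto
    then show ?thesis
      by (intro exI[of _ c]) simp
  qed
qed simp

text \<open>At an integral abscissa the curve is at an end of a non-vertical step or on a north
  step; in the latter case the upper end of the step serves.\<close>

lemma path_curve_lattice_point:
  assumes "(real i, c) \<in> path_curve P"
  shows "\<exists>j. c \<le> real j \<and> (i, j) \<in> lattice_points P"
proof -
  obtain A s B t where P: "P = A @ [s] @ B" and t: "0 \<le> t" "t \<le> 1"
    and i: "real i = real (fst (endpoint A)) + t * real (fst (step_vec s))"
    and c: "c = real (snd (endpoint A)) + t * real (snd (step_vec s))"
    using assms unfolding path_curve_iff closed_segment_step by blast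
  have pts: "endpoint A \<in> lattice_points P" "endpoint (A @ [s]) \<in> lattice_points P"
    by (simp_all add: P image_iff)
  obtain k l where kl: "endpoint A = (k, l)"
    by fastforce
  have "real k \<le> real i" "real i \<le> real (Suc k)"
    using t i kl by (cases s; simp)+
  then have "i = k \<or> i = Suc k"
    unfolding of_nat_le_iff by linarith
  then have "i = k \<and> (s = North \<or> t = 0) \<or> i = Suc k \<and> t = 1 \<and> s \<noteq> North"
    using t i kl by (cases s) auto
  then have "c \<le> real l \<and> (i, l) \<in> lattice_points P \<or>
      c \<le> real (Suc l) \<and> (i, Suc l) \<in> lattice_points P"
    using pts t c kl by (cases s) auto
  then show ?thesis
    by blast
qed

text \<open>
  As the path is weakly increasing, a cell lies in the region as soon as its upper left corner does;
  since that corner has an integral first coordinate, lattice points suffice.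
\<close>

lemma nonstrict_edges_eq:
  assumes "endpoint P = (n, n)"
  shows "nonstrict_edges P = {{x, y} | x y. (x, y) \<in> nonstrict_pairs P}"
proof -
  have "{real x - 1..real x} \<times> {real y - 1..real y} \<subseteq> path_region P \<longleftrightarrow>
      (\<exists>c\<ge>y. (x - 1, c) \<in> lattice_points P)" (is "?L \<longleftrightarrow> ?R")
    if xy: "1 \<le> x" "x < y" "y \<le> n" for x y
  proof
    assume ?L
    \<comment> \<open>The upper left corner of the cell is the only point tested.\<close>
    then have "(real x - 1, real y) \<in> path_region P"
      by auto
    then obtain c where "c \<ge> real y" "(real (x - 1), c) \<in> path_curve P"
      using xy by (auto simp: path_region_def of_nat_diff)
    then obtain j where "real y \<le> real j" "(x - 1, j) \<in> lattice_points P"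
      using path_curve_lattice_point by (meson order_trans)
    then show ?R
      by auto
  next
    assume ?R
    then obtain c A B where c: "c \<ge> y" "P = A @ B" "endpoint A = (x - 1, c)"
      by (auto simp: lattice_points_def)
    show ?L
    proof clarify
      fix a b assume ab: "a \<in> {real x - 1..real x}" "b \<in> {real y - 1..real y}"
      have "\<exists>d\<ge>real (snd (endpoint A)). (a, d) \<in> path_curve (A @ B)"
        using c xy ab assms by (intro path_curve_reaches) (auto simp del: endpoint_append)
      then obtain d where "real (snd (endpoint A)) \<le> d" "(a, d) \<in> path_curve P"
        using c by blast
      \<comment> \<open>The cell lies above the line \<open>y = x\<close>, because
        \<open>a \<le> x \<le> y - 1 \<le> b\<close>.\<close>
      then show "(a, b) \<in> path_region P"
        using c xy ab unfolding path_region_def by (auto intro!: exI[of _ d])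
    qed
  qed
  then show ?thesis
    using assms unfolding nonstrict_edges_def nonstrict_pairs_def path_size_def by fastforce
qed

lemma strict_edges_eq:
  assumes "endpoint P = (n, n)" "steps_above 0 P"
  shows "strict_edges P = {{x, y} | x y. (x, y) \<in> strict_pairs P}"
proof -
  have "1 \<le> x \<and> x < y \<and> y \<le> path_size P \<and> (x - 1, y - 1) \<in> diag_starts P \<longleftrightarrow>
      (x, y) \<in> strict_pairs P" for x y
  proof
    assume "1 \<le> x \<and> x < y \<and> y \<le> path_size P \<and> (x - 1, y - 1) \<in> diag_starts P"
    then show "(x, y) \<in> strict_pairs P"
      unfolding strict_pairs_def by (intro image_eqI[where x = "(x - 1, y - 1)"]) auto
  next
    assume "(x, y) \<in> strict_pairs P"
    then obtain i j where "x = Suc i" "y = Suc j" "(i, j) \<in> diag_starts P"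
      by (auto simp: strict_pairs_def)
    then show "1 \<le> x \<and> x < y \<and> y \<le> path_size P \<and> (x - 1, y - 1) \<in> diag_starts P"
      using assms diag_starts_le[of "(i, j)" P] diag_starts_above[OF assms(2), of "(i, j)"]
      by (simp add: path_size_def)
  qed
  moreover have "(\<exists>A B. P = A @ [Diag] @ B \<and> endpoint A = r) \<longleftrightarrow> r \<in> diag_starts P" for r
    by (auto simp: diag_starts_def)
  ultimately show ?thesis
    unfolding strict_edges_def by simp
qed

lemma pairs_inc:
  "nonstrict_pairs P \<subseteq> {(u, w). u < w}"
  "steps_above 0 P \<Longrightarrow> strict_pairs P \<subseteq> {(u, w). u < w}"
  using diag_starts_above[of "0" P]
  by (auto simp: nonstrict_pairs_def strict_pairs_def)

lemma pairs_vertices: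
  assumes "endpoint P = (n, n)"
  shows "nonstrict_pairs P \<subseteq> {1..n} \<times> {1..n}" "strict_pairs P \<subseteq> {1..n} \<times> {1..n}"
  using assms diag_starts_le[of _ P]
  by (auto simp: nonstrict_pairs_def strict_pairs_def path_size_def Suc_le_eq)

lemma pairs_finite:
  assumes "endpoint P = (n, n)"
  shows "finite (nonstrict_pairs P)" "finite (strict_pairs P)"
  using pairs_vertices[OF assms] by (auto intro: finite_subset)

text \<open>Once a diagonal step leaves \<open>(x, y)\<close>, the path has left column
  \<open>x\<close>, so that column has no lattice point higher than \<open>y\<close>.\<close>

lemma pairs_disjoint: "nonstrict_pairs P \<inter> strict_pairs P = {}"
proof -
  have False if "(x, y) \<in> diag_starts P" "c > y" "(x, c) \<in> lattice_points P" for x y c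
  proof -
    from that(1) obtain A B where "(x, y) = endpoint A" "P = A @ [Diag] @ B"
      unfolding diag_starts_def by blast
    then show False
      using that(2,3) lattice_points_split[of P A Diag B "(x, c)"] by (simp flip: \<open>(x, y) = endpoint A\<close>)
  qed
  then show ?thesis
    by (fastforce simp: nonstrict_pairs_def strict_pairs_def)
qed

text \<open>Intersecting with \<open>N\<close> is a bijection from the orientations to the subsets
  of \<open>N\<close>, and the intersection is the set of ascending edges.\<close>

lemma LLTe_eq_graph_sum:
  assumes P: "endpoint P = (n, n)" "steps_above 0 P"
  shows "LLTe P = graph_sum {1..n} (nonstrict_pairs P) (strict_pairs P)"
proof -
  define N S where "N = nonstrict_pairs P" and "S = strict_pairs P"
  have inc: "u < w" if "(u, w) \<in> N \<union> S" for u w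
    using that pairs_inc[of P] P(2) by (auto simp: N_def S_def)
  have asym: "(w, u) \<notin> N \<union> S" if "(u, w) \<in> N \<union> S" for u w
    using inc that by (meson less_asym)
  have disj: "N \<inter> S = {}"
    unfolding N_def S_def by (rule pairs_disjoint)
  have N: "{u, w} \<in> nonstrict_edges P \<longleftrightarrow> (u, w) \<in> N \<or> (w, u) \<in> N" for u w
    unfolding nonstrict_edges_eq[OF P(1)] N_def by (auto simp: doubleton_eq_iff)
  have S: "{u, w} \<in> strict_edges P \<longleftrightarrow> (u, w) \<in> S \<or> (w, u) \<in> S" for u w
    unfolding strict_edges_eq[OF P] S_def by (auto simp: doubleton_eq_iff)
  have asc: "ascending_edges P \<theta> = \<theta> \<inter> N" for \<theta>
    using inc unfolding ascending_edges_def N by fastforce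
  \<comment> \<open>The inverse bijection: strict edges ascend, edges in \<open>T\<close> ascend,
    and the remaining non-strict edges are reversed.\<close>
  define orient where "orient T = S \<union> T \<union> (N - T)\<inverse>" for T
  have orient: "\<theta> \<in> orientations P \<longleftrightarrow> S \<subseteq> \<theta> \<and> \<theta> \<subseteq> N \<union> S \<union> (N \<union> S)\<inverse> \<and>
      (\<forall>u w. (u, w) \<in> N \<union> S \<longrightarrow> ((u, w) \<in> \<theta> \<longleftrightarrow> (w, u) \<notin> \<theta>))" for \<theta>
  proof -
    have "\<theta> \<in> orientations P \<longleftrightarrow>
        ((\<forall>(u, w)\<in>\<theta>. ((u, w) \<in> N \<or> (w, u) \<in> N) \<or> (u, w) \<in> S \<or> (w, u) \<in> S) \<and>
         (\<forall>u w. ((u, w) \<in> N \<or> (w, u) \<in> N) \<or> (u, w) \<in> S \<or> (w, u) \<in> S \<longrightarrow>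
            ((u, w) \<in> \<theta> \<longleftrightarrow> (w, u) \<notin> \<theta>))) \<and>
        (\<forall>u w. u < w \<and> ((u, w) \<in> S \<or> (w, u) \<in> S) \<longrightarrow> (u, w) \<in> \<theta>)"
      unfolding orientations_def orientation_def mem_Collect_eq N S Un_iff by (rule refl)
    moreover have "(\<forall>u w. u < w \<and> ((u, w) \<in> S \<or> (w, u) \<in> S) \<longrightarrow> (u, w) \<in> \<theta>) \<longleftrightarrow> S \<subseteq> \<theta>"
      using inc by (meson Un_iff not_less_iff_gr_or_eq subrelI subsetD)
    moreover have "(\<forall>(u, w)\<in>\<theta>. ((u, w) \<in> N \<or> (w, u) \<in> N) \<or> (u, w) \<in> S \<or> (w, u) \<in> S) \<longleftrightarrow>
        \<theta> \<subseteq> N \<union> S \<union> (N \<union> S)\<inverse>"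
      by auto
    moreover have "(\<forall>u w. ((u, w) \<in> N \<or> (w, u) \<in> N) \<or> (u, w) \<in> S \<or> (w, u) \<in> S \<longrightarrow>
          ((u, w) \<in> \<theta> \<longleftrightarrow> (w, u) \<notin> \<theta>)) \<longleftrightarrow>
        (\<forall>u w. (u, w) \<in> N \<union> S \<longrightarrow> ((u, w) \<in> \<theta> \<longleftrightarrow> (w, u) \<notin> \<theta>))"
      by blast
    ultimately show ?thesis
      by argo
  qed
  show ?thesis
    unfolding LLTe_def graph_sum_def N_def[symmetric] S_def[symmetric]
  proof (rule sum.reindex_bij_witness[where i = orient and j = "\<lambda>\<theta>. \<theta> \<inter> N"])
    fix \<theta> assume \<theta>: "\<theta> \<in> orientations P"
    show eq: "orient (\<theta> \<inter> N) = \<theta>"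
    proof -
      have "\<theta> \<subseteq> N \<union> S \<union> (N \<union> S)\<inverse>" "S \<subseteq> \<theta>"
        and flip: "\<And>u w. (u, w) \<in> N \<union> S \<Longrightarrow> (u, w) \<in> \<theta> \<longleftrightarrow> (w, u) \<notin> \<theta>"
        using \<theta> unfolding orient by blast+
      moreover have "(w, u) \<notin> \<theta>" if "(u, w) \<in> S" for u w
        using flip[of u w] that \<open>S \<subseteq> \<theta>\<close> by blast
      ultimately show ?thesis
        unfolding orient_def by blast
    qed
    show "\<theta> \<inter> N \<in> Pow N"
      by simp
    have "{(a, b) \<in> \<theta>. {a, b} \<in> strict_edges P} = S"
      using \<theta> unfolding orient S by auto
    then have "hrv P \<theta> = reach_max (S \<union> \<theta> \<inter> N)"
      by (intro ext) (simp add: hrv_def reach_max_def asc Image_singleton)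
    then have "hrv_partition P \<theta> = image_mset card (mset_set (level_sets {1..n} (reach_max (S \<union> \<theta> \<inter> N))))"
      using P(1) unfolding hrv_partition_def level_sets_def vertices_def path_size_def Setcompr_eq_image
      by simp
    then show "(q - 1) ^ card (\<theta> \<inter> N) *\<^sub>K elem_sym_levels {1..n} (reach_max (S \<union> \<theta> \<inter> N)) =
        (q - 1) ^ asc P \<theta> *\<^sub>K elem_sym_part (hrv_partition P \<theta>)"
      by (simp add: elem_sym_levels_def asc_def asc)
  next
    fix T assume T: "T \<in> Pow N"
    show "orient T \<inter> N = T"
      using T disj asym unfolding orient_def by blast
    show "orient T \<in> orientations P"
      unfolding orient orient_def using T disj asym by blast
  qed
qed

section \<open>Corner and bounce relations\<close>

lemma lattice_points_prefix: "endpoint A \<in> lattice_points (A @ B)"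
  unfolding lattice_points_def by blast

lemma endpoint_replicate_Diag: "endpoint (replicate k Diag) = (k, k)"
  by (induction k) (auto simp: zero_prod_def)

lemma lattice_points_replicate_Diag: "lattice_points (replicate k Diag) = (\<lambda>i. (i, i)) ` {..k}"
  by (induction k) (auto simp: zero_prod_def atMost_Suc_eq_insert_0 image_image)

lemma diag_starts_replicate_Diag: "diag_starts (replicate k Diag) = (\<lambda>i. (i, i)) ` {..<k}"
  by (induction k) (auto simp: zero_prod_def lessThan_Suc_eq_insert_0 image_image)

lemma steps_above_replicate_Diag: "fst p < snd p \<Longrightarrow> steps_above p (replicate k Diag)"
  by (induction k arbitrary: p) auto

lemma elem_sym_levels_const:
  assumes "finite V" "V \<noteq> {}" "\<And>u. u \<in> V \<Longrightarrow> h u = c"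
  shows "elem_sym_levels V h = elem_sym (card V)"
proof -
  have "level_sets V h = {V}"
    using assms unfolding level_sets_def by auto
  then show ?thesis
    by (simp add: elem_sym_levels_def elem_sym_part_def)
qed

lemma reach_max_successors:
  assumes "1 \<le> u" "u \<le> Suc k"
  shows "reach_max ((\<lambda>i. (Suc i, Suc (Suc i))) ` {..<k}) u = Suc k"
proof -
  let ?R = "(\<lambda>i. (Suc i, Suc (Suc i))) ` {..<k}"
  have "(u, Suc k) \<in> ?R\<^sup>*"
    using assms(2)
  proof (induction rule: inc_induct)
    case (step w)
    \<comment> \<open>The relation is indexed from 0 while vertices start at 1, hence the witness
      \<open>w - 1\<close>.\<close>
    then have "(w, Suc w) \<in> ?R"
      using assms(1) by (intro image_eqI[of _ _ "w - 1"]) auto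
    then show ?case
      using step.IH by (rule converse_rtrancl_into_rtrancl)
  qed simp
  moreover have "w \<le> Suc k" if "(u, w) \<in> ?R\<^sup>*" for w
    using that assms(2) by (auto elim: rtranclE)
  ultimately show ?thesis
    unfolding reach_max_def by (intro Max_eqI finite_reach) auto
qed

lemma north_diags_east_path:
  "endpoint ([North] @ replicate k Diag @ [East]) = (Suc k, Suc k)"
  "steps_above 0 ([North] @ replicate k Diag @ [East])"
  by (simp_all add: endpoint_replicate_Diag steps_above_replicate_Diag)

text \<open>The strict edges form the chain from 1 to \<open>Suc k\<close> and there are no others,
  so all vertices reach \<open>Suc k\<close> and form one class.\<close>

lemma LLTe_north_diags_east: "LLTe ([North] @ replicate k Diag @ [East]) = elem_sym (k + 1)"
proof -
  let ?P = "[North] @ replicate k Diag @ [East]"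
  note P = north_diags_east_path[of k]
  have "nonstrict_pairs ?P = {}"
    by (auto simp: nonstrict_pairs_def lattice_points_replicate_Diag endpoint_replicate_Diag zero_prod_def)
  moreover have "strict_pairs ?P = (\<lambda>i. (Suc i, Suc (Suc i))) ` {..<k}"
    by (simp add: strict_pairs_def diag_starts_replicate_Diag image_image)
  ultimately show ?thesis
    unfolding LLTe_eq_graph_sum[OF P] graph_sum_def
    using elem_sym_levels_const[where V = "{1..Suc k}", OF _ _ reach_max_successors[of _ k]]
    by (simp add: sf_scale_algebra(4))
qed

section \<open>Multiplicativity under concatenation\<close>

lemma reach_max_Un:
  assumes "finite R" "R \<subseteq> V \<times> V" "R' \<subseteq> W \<times> W" "V \<inter> W = {}" "u \<in> V"
  shows "reach_max (R \<union> R') u = reach_max R u" "reach_max R u \<in> V"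
proof -
  have *: "(u, w) \<in> R\<^sup>* \<and> w \<in> V" if "(u, w) \<in> (R \<union> R')\<^sup>*" for w
    using that
  proof (induction rule: rtrancl_induct)
    case (step y z)
    then have "(y, z) \<in> R"
      using assms by auto
    with step.IH assms show ?case
      by (auto intro: rtrancl_into_rtrancl)
  qed (use assms in simp)
  moreover have "R\<^sup>* \<subseteq> (R \<union> R')\<^sup>*"
    by (intro rtrancl_mono) simp
  ultimately have "(R \<union> R')\<^sup>* `` {u} = R\<^sup>* `` {u}"
    by blast
  then show "reach_max (R \<union> R') u = reach_max R u"
    by (simp add: reach_max_def)
  have "R\<^sup>* `` {u} \<subseteq> V"
    using * \<open>R\<^sup>* \<subseteq> (R \<union> R')\<^sup>*\<close> by blast
  moreover have "Max (R\<^sup>* `` {u}) \<in> R\<^sup>* `` {u}"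
    using finite_reach[OF assms(1)] by (intro Max_in) auto
  ultimately show "reach_max R u \<in> V"
    unfolding reach_max_def by blast
qed

text \<open>A subset of \<open>N \<union> N'\<close> is a pair of subsets, cardinalities add, and
  walks stay within their block, so every summand factors.\<close>

lemma graph_sum_Un:
  assumes fin: "finite V" "finite W" and disj: "V \<inter> W = {}"
    and sub: "N \<subseteq> V \<times> V" "S \<subseteq> V \<times> V" "N' \<subseteq> W \<times> W" "S' \<subseteq> W \<times> W"
  shows "graph_sum (V \<union> W) (N \<union> N') (S \<union> S') = graph_sum V N S * graph_sum W N' S'"
proof -
  let ?e = "\<lambda>T T'. elem_sym_levels V (reach_max (S \<union> T)) * elem_sym_levels W (reach_max (S' \<union> T'))"
  have disjN: "N \<inter> N' = {}"
    using sub disj by blast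
  have levels: "elem_sym_levels (V \<union> W) (reach_max (S \<union> S' \<union> (T \<union> T'))) = ?e T T'"
    if T: "T \<subseteq> N" "T' \<subseteq> N'" for T T'
  proof -
    let ?R = "S \<union> T" and ?R' = "S' \<union> T'"
    have R: "?R \<subseteq> V \<times> V" "?R' \<subseteq> W \<times> W"
      using sub T by auto
    have finR: "finite ?R" "finite ?R'"
      using R fin by (meson finite_SigmaI finite_subset)+
    have eq: "S \<union> S' \<union> (T \<union> T') = ?R \<union> ?R'" "?R' \<union> ?R = ?R \<union> ?R'"
      by auto
    have V: "reach_max (?R \<union> ?R') u = reach_max ?R u" "reach_max ?R u \<in> V" if "u \<in> V" for u
      using reach_max_Un[OF finR(1) R disj that] by auto
    have W: "reach_max (?R \<union> ?R') u = reach_max ?R' u" "reach_max ?R' u \<in> W" if "u \<in> W" for u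
      using reach_max_Un[OF finR(2) R(2,1) _ that] disj eq(2) by (auto simp: Int_commute)
    have "elem_sym_levels (V \<union> W) (reach_max (?R \<union> ?R')) =
        elem_sym_levels V (reach_max (?R \<union> ?R')) * elem_sym_levels W (reach_max (?R \<union> ?R'))"
    proof (rule elem_sym_levels_Un[OF fin disj])
      have "reach_max (?R \<union> ?R') ` V \<subseteq> V" "reach_max (?R \<union> ?R') ` W \<subseteq> W"
        using V W by auto
      then show "reach_max (?R \<union> ?R') ` V \<inter> reach_max (?R \<union> ?R') ` W = {}"
        using disj by blast
    qed
    also have "\<dots> = ?e T T'"
      using V W by (intro arg_cong2[where f = "(*)"] elem_sym_levels_cong) auto
    finally show ?thesis
      by (simp only: eq)
  qed
  have card: "card (T \<union> T') = card T + card T'" if "T \<subseteq> N" "T' \<subseteq> N'" for T T'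
  proof (rule card_Un_disjoint)
    show "finite T" "finite T'"
      using that sub fin by (meson finite_SigmaI finite_subset)+
  qed (use that disjN in auto)
  have "graph_sum (V \<union> W) (N \<union> N') (S \<union> S') =
      (\<Sum>(T, T')\<in>Pow N \<times> Pow N'. (q - 1) ^ (card T + card T') *\<^sub>K ?e T T')"
    unfolding graph_sum_def
    using disjN
    by (intro sum.reindex_bij_witness[where i = "\<lambda>(T, T'). T \<union> T'" and j = "\<lambda>T. (T \<inter> N, T \<inter> N')"])
       (auto simp: levels[symmetric] card[symmetric] simp flip: Int_Un_distrib simp: Int_absorb2)
  also have "\<dots> = graph_sum V N S * graph_sum W N' S'"
    unfolding graph_sum_def sum_product sum.cartesian_product
    by (simp add: sf_scale_algebra power_add mult.commute)
  finally show ?thesis .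
qed

text \<open>A strictly monotone relabelling commutes with all maxima, so unlike a transposition it
  needs no special edge.\<close>

lemma graph_sum_image:
  assumes "strict_mono f" "finite N" "finite S"
  shows "graph_sum (f ` V) (map_prod f f ` N) (map_prod f f ` S) = graph_sum V N S"
proof -
  let ?f = "map_prod f f"
  have inj: "inj f"
    using assms(1) by (rule strict_mono_imp_inj_on)
  then have inj2: "inj ?f"
    by (simp add: prod.inj_map)
  have "elem_sym_levels (f ` V) (reach_max (?f ` R)) = elem_sym_levels V (reach_max R)"
    if "finite R" for R
  proof (rule elem_sym_levels_transport[where f = f and g = f])
    fix u
    have "Max (f ` (R\<^sup>* `` {u})) = f (Max (R\<^sup>* `` {u}))"
      using finite_reach[OF that] assms(1)
      by (intro mono_Max_commute[symmetric]) (auto simp: strict_mono_mono)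
    then show "reach_max (?f ` R) (f u) = f (reach_max R u)"
      unfolding reach_max_def rtrancl_image_map_prod[OF inj] .
  qed (use inj in \<open>auto simp: bij_betw_def intro: inj_on_subset\<close>)
  then have "elem_sym_levels (f ` V) (reach_max (?f ` S \<union> ?f ` T)) = elem_sym_levels V (reach_max (S \<union> T))"
    if "T \<in> Pow N" for T
    using that assms(2,3) finite_subset[of T N] by (simp flip: image_Un)
  moreover have "card (?f ` T) = card T" for T
    using inj2 by (meson card_image inj_on_subset subset_UNIV)
  moreover have "inj_on (image ?f) (Pow N)"
    using inj2 by (meson inj_on_image_Pow inj_on_subset subset_UNIV)
  moreover have "Pow (?f ` N) = image ?f ` Pow N"
    by (simp add: image_Pow_surj)
  ultimately show ?thesis
    unfolding graph_sum_def by (simp add: sum.reindex)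
qed

text \<open>No cell crosses the cut: points of \<open>P\<close> have height at most
  \<open>m\<close>, and shifted points of \<open>Q\<close> have abscissa at least
  \<open>m\<close>.\<close>

lemma nonstrict_pairs_append:
  assumes "endpoint P = (m, m)" "endpoint Q = (n, n)"
  shows "nonstrict_pairs (P @ Q) = nonstrict_pairs P \<union> map_prod ((+) m) ((+) m) ` nonstrict_pairs Q"
proof (intro equalityI subrelI)
  fix x y assume "(x, y) \<in> nonstrict_pairs (P @ Q)"
  then obtain c where xy: "1 \<le> x" "x < y" "y \<le> m + n" "y \<le> c"
    and "(x - 1, c) \<in> lattice_points P \<or> (\<exists>a b. (a, b) \<in> lattice_points Q \<and> x - 1 = m + a \<and> c = m + b)"
    using assms by (auto simp: nonstrict_pairs_def path_size_def)
  then consider "(x - 1, c) \<in> lattice_points P"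
    | a b where "(a, b) \<in> lattice_points Q" "x - 1 = m + a" "c = m + b"
    by blast
  then show "(x, y) \<in> nonstrict_pairs P \<union> map_prod ((+) m) ((+) m) ` nonstrict_pairs Q"
  proof cases
    case 1
    then show ?thesis
      using xy lattice_points_le[OF 1] assms by (auto simp: nonstrict_pairs_def path_size_def)
  next
    case 2
    then have "x = m + Suc a"
      using xy by simp
    with 2 have "(Suc a, y - m) \<in> nonstrict_pairs Q"
      using xy assms by (auto simp: nonstrict_pairs_def path_size_def intro!: exI[of _ b])
    then show ?thesis
      using \<open>x = m + Suc a\<close> xy by (intro UnI2 image_eqI[of _ _ "(Suc a, y - m)"]) auto
  qed
next
  fix x y assume "(x, y) \<in> nonstrict_pairs P \<union> map_prod ((+) m) ((+) m) ` nonstrict_pairs Q"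
  then consider "(x, y) \<in> nonstrict_pairs P"
    | x' y' where "(x', y') \<in> nonstrict_pairs Q" "x = m + x'" "y = m + y'"
    by auto
  then show "(x, y) \<in> nonstrict_pairs (P @ Q)"
  proof cases
    case 1
    then show ?thesis
      using assms by (auto simp: nonstrict_pairs_def path_size_def)
  next
    case 2
    then obtain c where c: "1 \<le> x'" "x' < y'" "y' \<le> n" "y' \<le> c" "(x' - 1, c) \<in> lattice_points Q"
      using assms by (auto simp: nonstrict_pairs_def path_size_def)
    then have "(x - 1, m + c) \<in> lattice_points (P @ Q)"
      using 2 assms by (auto intro!: image_eqI[of _ _ "(x' - 1, c)"])
    then show ?thesis
      using 2 c assms by (auto simp: nonstrict_pairs_def path_size_def simp del: lattice_points_append intro!: exI[of _ "m + c"])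
  qed
qed

lemma strict_pairs_append:
  assumes "endpoint P = (m, m)"
  shows "strict_pairs (P @ Q) = strict_pairs P \<union> map_prod ((+) m) ((+) m) ` strict_pairs Q"
  using assms by (auto simp: strict_pairs_def image_Un image_image case_prod_unfold)

lemma LLTe_append:
  assumes P: "endpoint P = (m, m)" "steps_above 0 P" and Q: "endpoint Q = (n, n)" "steps_above 0 Q"
  shows "endpoint (P @ Q) = (m + n, m + n)" "steps_above 0 (P @ Q)" "LLTe (P @ Q) = LLTe P * LLTe Q"
proof -
  \<comment> \<open>Whether steps stay above the line \<open>y = x\<close> is unaffected by a
    translation along that line.\<close>
  have shift: "steps_above (p + (m, m)) R = steps_above p R" for p R
  proof (induction R arbitrary: p)
    case (Cons s R)
    have "p + (m, m) + step_vec s = p + step_vec s + (m, m)"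
      by (simp only: ac_simps)
    then show ?case
      by (simp add: Cons.IH)
  qed simp
  show PQ: "endpoint (P @ Q) = (m + n, m + n)" "steps_above 0 (P @ Q)"
    using P Q shift[of 0 Q] by simp_all
  let ?f = "map_prod ((+) m) ((+) m)"
  have V: "{1..m + n} = {1..m} \<union> (+) m ` {1..n}"
    by auto
  have sub: "?f ` nonstrict_pairs Q \<subseteq> (+) m ` {1..n} \<times> (+) m ` {1..n}"
      "?f ` strict_pairs Q \<subseteq> (+) m ` {1..n} \<times> (+) m ` {1..n}"
    using pairs_vertices[OF Q(1)] by auto
  have "LLTe (P @ Q) = graph_sum {1..m} (nonstrict_pairs P) (strict_pairs P) *
      graph_sum ((+) m ` {1..n}) (?f ` nonstrict_pairs Q) (?f ` strict_pairs Q)"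
    unfolding LLTe_eq_graph_sum[OF PQ] nonstrict_pairs_append[OF P(1) Q(1)] strict_pairs_append[OF P(1)] V
    using pairs_vertices[OF P(1)] sub by (intro graph_sum_Un) auto
  also have "graph_sum ((+) m ` {1..n}) (?f ` nonstrict_pairs Q) (?f ` strict_pairs Q) =
      graph_sum {1..n} (nonstrict_pairs Q) (strict_pairs Q)"
    using pairs_finite[OF Q(1)] by (intro graph_sum_image) (auto simp: strict_mono_def)
  finally show "LLTe (P @ Q) = LLTe P * LLTe Q"
    by (simp add: LLTe_eq_graph_sum[OF P] LLTe_eq_graph_sum[OF Q])
qed

section \<open>The corner relation\<close>

lemma LLTe_corner:
  assumes P: "endpoint (U @ [Diag] @ V) = (n, n)" "steps_above 0 (U @ [Diag] @ V)"
  shows "endpoint (U @ [North, East] @ V) = (n, n)" "steps_above 0 (U @ [North, East] @ V)"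
    and "endpoint (U @ [East, North] @ V) = (n, n)" "steps_above 0 (U @ [East, North] @ V)"
    and "LLTe (U @ [North, East] @ V) - LLTe (U @ [East, North] @ V) = (q - 1) *\<^sub>K LLTe (U @ [Diag] @ V)"
proof -
  let ?P = "U @ [Diag] @ V" and ?ne = "U @ [North, East] @ V" and ?en = "U @ [East, North] @ V"
  have steps: "step_vec North + (step_vec East + r) = step_vec Diag + r"
      "step_vec East + (step_vec North + r) = step_vec Diag + r" for r
    by (simp_all flip: add.assoc)
  show ne: "endpoint ?ne = (n, n)" "steps_above 0 ?ne"
    and en: "endpoint ?en = (n, n)" "steps_above 0 ?en"
    using P by (simp_all add: steps add.assoc del: step_vec.simps) (simp_all add: add.assoc)
  obtain i j where ij: "endpoint U = (i, j)"
    by fastforce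
  have "i < j"
    using P(2) ij by simp
  have "j < n"
    using P(1) ij by (auto simp: prod_eq_iff)
  have pts: "lattice_points ?ne = insert (i, Suc j) (lattice_points ?P)"
      "lattice_points ?en = insert (Suc i, j) (lattice_points ?P)"
    using ij by (simp_all add: image_image steps add.assoc insert_commute del: step_vec.simps) (auto simp: ij)
  have corner: "(i, j) \<in> lattice_points ?P" "(Suc i, Suc j) \<in> lattice_points ?P"
    using ij lattice_points_prefix[of U "[Diag] @ V"] lattice_points_prefix[of "U @ [Diag]" V] by simp_all
  \<comment> \<open>Points before the diagonal step have height at most \<open>j\<close>; those
    after it have abscissa at least \<open>Suc i\<close>.\<close>
  have below: "c \<le> j" if "(i, c) \<in> lattice_points ?P" for c
    using lattice_points_split[of ?P U Diag V "(i, c)"] that ij by auto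
  have size: "path_size ?P = n" "path_size ?ne = n" "path_size ?en = n"
    using P(1) ne(1) en(1) by (simp_all only: path_size_def fst_conv)
  \<comment> \<open>The three graphs differ only in the pair \<open>(Suc i, Suc j)\<close>:
    non-strict for \<open>?ne\<close>, absent for \<open>?en\<close>, strict for \<open>?P\<close>.
    This is the situation of \<open>graph_sum_insert\<close>.\<close>
  have N_ne: "nonstrict_pairs ?ne = insert (Suc i, Suc j) (nonstrict_pairs ?P)"
  proof (intro set_eqI; clarify)
    fix x y
    show "(x, y) \<in> nonstrict_pairs ?ne \<longleftrightarrow> (x, y) \<in> insert (Suc i, Suc j) (nonstrict_pairs ?P)"
      unfolding nonstrict_pairs_def size pts using corner(1) \<open>i < j\<close> \<open>j < n\<close>
      by (auto simp del: lattice_points_append append.simps) (metis Suc_pred le_SucE le_antisym not_less_eq_eq)+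
  qed
  have N_en: "nonstrict_pairs ?en = nonstrict_pairs ?P"
  proof (intro set_eqI; clarify)
    fix x y
    show "(x, y) \<in> nonstrict_pairs ?en \<longleftrightarrow> (x, y) \<in> nonstrict_pairs ?P"
      unfolding nonstrict_pairs_def size pts using corner(2)
      by (auto simp del: lattice_points_append append.simps intro: le_SucI)
  qed
  have new: "(Suc i, Suc j) \<notin> nonstrict_pairs ?P"
    using below by (fastforce simp: nonstrict_pairs_def simp del: lattice_points_append append.simps)
  have S: "strict_pairs ?ne = strict_pairs ?en" "strict_pairs ?P = insert (Suc i, Suc j) (strict_pairs ?en)"
    using ij by (simp_all add: strict_pairs_def image_image steps image_Un del: step_vec.simps)
  show "LLTe ?ne - LLTe ?en = (q - 1) *\<^sub>K LLTe ?P"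
    unfolding LLTe_eq_graph_sum[OF P] LLTe_eq_graph_sum[OF ne] LLTe_eq_graph_sum[OF en] N_ne N_en S
    using graph_sum_insert[OF pairs_finite(1)[OF P(1)] new] by simp
qed

section \<open>The bounce relation\<close>

lemma image_eq_if_involution:
  assumes "\<And>x. f (f x) = x" "\<And>x. x \<in> A \<Longrightarrow> f x \<in> A"
  shows "f ` A = A"
proof (intro equalityI subsetI)
  fix x assume "x \<in> A"
  then have "f (f x) \<in> f ` A"
    using assms(2) by blast
  then show "x \<in> f ` A"
    by (simp add: assms(1))
qed (use assms(2) in auto)

text \<open>The twins are \<open>x\<close> and \<open>Suc x\<close>. Passing from \<open>P\<close>
  to \<open>P'\<close> replaces the strict edge \<open>(x, z)\<close> by \<open>(Suc x, z)\<close>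
  and drops the latter as a non-strict edge. If \<open>s\<close> is diagonal, the strict edge
  \<open>(v, x)\<close> likewise becomes \<open>(v, Suc x)\<close>, and \<open>(v, x)\<close>
  becomes non-strict.\<close>

lemma LLTe_bounce:
  assumes P: "endpoint (U @ [s, North] @ V @ [Diag, East] @ W) = (n, n)"
      "steps_above 0 (U @ [s, North] @ V @ [Diag, East] @ W)"
    and s: "s \<in> {North, Diag}"
    and v: "endpoint (U @ [s]) = (v, x)"
    and z: "endpoint (U @ [s, North] @ V @ [Diag]) = (x, z)" and "x + 1 < z"
  defines "P \<equiv> U @ [s, North] @ V @ [Diag, East] @ W"
    and "P' \<equiv> U @ [North, s] @ V @ [East, Diag] @ W"
  shows "endpoint P' = (n, n)" "steps_above 0 P'"
    and "LLTe P = (if s = North then q *\<^sub>K LLTe P' else LLTe P')"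
proof -
  obtain g h where U: "endpoint U = (g, h)"
    by fastforce
  obtain k l where V: "endpoint V = (k, l)"
    by fastforce
  have h: "x = Suc h" and v': "v = (if s = North then g else Suc g)"
    using s v U by auto
  have x: "x = Suc (v + k)" and z': "z = Suc (Suc (x + l))"
    using z v V by (cases s; simp add: U)+
  have W: "endpoint W + (Suc x, z) = (n, n)"
    using P(1) z v by (auto simp: U V prod_eq_iff)
  have add_pair: "(a, b) + ((c, d) + r) = (a + c, b + d) + r" for a b c d :: nat and r
    by (cases r) simp
  have "g \<le> h" if "s = North"
    using lattice_points_above[OF P(2), of "endpoint U"] U by simp
  moreover have "g < h" if "s = Diag"
    using P(2) U that by simp
  ultimately have gh: "g \<le> h" "v \<le> h" "s = Diag \<Longrightarrow> g < h"
    using s v' by auto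
  show P': "endpoint P' = (n, n)" "steps_above 0 P'"
    using P gh s \<open>x + 1 < z\<close> x z' h v' unfolding P'_def
    by (auto simp: U V add_pair)
  \<comment> \<open>In both paths \<open>V\<close> starts at \<open>(v, Suc x)\<close> and
    \<open>W\<close> at \<open>(Suc x, z)\<close>, so these points are common to \<open>P\<close>
    and \<open>P'\<close>.\<close>
  define LU LV LW where L_defs: "LU = lattice_points U" "LV = (+) (v, Suc x) ` lattice_points V"
    "LW = (+) (Suc x, z) ` lattice_points W"
  have hk: "h = v + k"
    using x h by simp
  have step: "s = North \<and> g = v \<or> s = Diag \<and> v = Suc g"
    using s v' by auto
  have mem: "(g, h) \<in> LU" "(v, Suc x) \<in> LV" "(x - 1, z - 1) \<in> LV"
    using lattice_points_prefix[of U "[]"] lattice_points_prefix[of V "[]"] U V x z'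
    by (auto simp: L_defs intro: image_eqI[of _ _ "(k, l)"] image_eqI[of _ _ 0])
  have "lattice_points P =
      insert (g, h) (insert (v, x) (insert (x - 1, z - 1) (insert (x, z) (LU \<union> LV \<union> LW))))"
    using step unfolding P_def L_defs
    by (elim disjE) (simp_all add: U V image_Un image_image add_pair hk x z' Un_assoc)
  then have pts: "lattice_points P = insert (v, x) (insert (x, z) (LU \<union> LV \<union> LW))"
    using mem by auto
  have "lattice_points P' =
      insert (g, h) (insert (g, x) (insert (v, Suc x) (insert (x - 1, z - 1) (insert (x, z - 1) (LU \<union> LV \<union> LW)))))"
    using step mem(2) unfolding P'_def L_defs
    by (elim disjE) (simp_all add: U V image_Un image_image add_pair hk x z' Un_assoc insert_absorb)
  then have pts': "lattice_points P' = insert (g, x) (insert (x, z - 1) (LU \<union> LV \<union> LW))"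
    using mem by auto
  \<comment> \<open>The starts of the diagonal steps common to both paths.\<close>
  define D where "D = diag_starts U \<union> (+) (v, Suc x) ` diag_starts V \<union> (+) (Suc x, z) ` diag_starts W"
  define S where "S = (\<lambda>(i, j). (Suc i, Suc j)) ` D"
  have "diag_starts P = (if s = Diag then {(g, h)} else {}) \<union> {(x - 1, z - 1)} \<union> D"
    using step unfolding P_def D_def
    by (elim disjE) (simp_all add: U V image_Un image_image add_pair hk x z' Un_assoc)
  then have S: "strict_pairs P = (if s = Diag then {(v, x)} else {}) \<union> {(x, z)} \<union> S"
    using step h x z' by (auto simp: strict_pairs_def S_def image_Un)
  have "diag_starts P' = (if s = Diag then {(g, x)} else {}) \<union> {(x, z - 1)} \<union> D"
    using step unfolding P'_def D_def
    by (elim disjE) (simp_all add: U V image_Un image_image add_pair hk x z' Un_assoc)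
  then have S': "strict_pairs P' = (if s = Diag then {(v, Suc x)} else {}) \<union> {(Suc x, z)} \<union> S"
    using step h x z' by (auto simp: strict_pairs_def S_def image_Un)
  have LU: "i \<le> g" "j \<le> h" if "(i, j) \<in> LU" for i j
    using that lattice_points_le[of _ U] U by (force simp: L_defs)+
  have LV: "v \<le> i" "i < x" "x < j" "j < z" if "(i, j) \<in> LV" for i j
    using that lattice_points_le[of _ V] V x z' by (force simp: L_defs)+
  have LW: "x < i" "z \<le> j" if "(i, j) \<in> LW" for i j
    using that by (auto simp: L_defs)
  \<comment> \<open>cell \<open>(u, w)\<close> lies below a lattice point shared by \<open>P\<close> and \<open>P'\<close>\<close>
  define Q where "Q u w \<longleftrightarrow> (\<exists>c\<ge>w. (u - 1, c) \<in> LU \<union> LV \<union> LW)" for u w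
  \<comment> \<open>The highest shared point in column \<open>x - 1\<close> is
    \<open>(x - 1, z - 1)\<close>, where \<open>V\<close> ends.\<close>
  have Q_x: "Q x w \<longleftrightarrow> w < z" if "x < w" for w
  proof
    assume "Q x w"
    then obtain c where "w \<le> c" "(x - 1, c) \<in> LU \<or> (x - 1, c) \<in> LV \<or> (x - 1, c) \<in> LW"
      unfolding Q_def by blast
    then show "w < z"
      using LU(2)[of "x - 1" c] LV(4)[of "x - 1" c] LW(1)[of "x - 1" c] h that by auto
  next
    assume "w < z"
    then show "Q x w"
      using mem(3) unfolding Q_def by (intro exI[of _ "z - 1"]) auto
  qed
  \<comment> \<open>Column \<open>x\<close> contains no shared point; the larger neighbours of
    \<open>Suc x\<close> come from \<open>(x, z)\<close> in \<open>P\<close> and from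
    \<open>(x, z - 1)\<close> in \<open>P'\<close>.\<close>
  have Q_Suc_x: "\<not> Q (Suc x) w" for w
    unfolding Q_def using LU(1)[of x] LV(2)[of x] LW(1)[of x] h gh by fastforce
  \<comment> \<open>No shared point has height \<open>x\<close>, so the shared cells of rows
    \<open>x\<close> and \<open>Suc x\<close> lie in the same columns.\<close>
  have Q_row: "Q u x \<longleftrightarrow> Q u (Suc x)" for u
  proof
    assume "Q u x"
    then obtain c where c: "x \<le> c" "(u - 1, c) \<in> LU \<union> LV \<union> LW"
      unfolding Q_def by blast
    then have "c \<noteq> x"
      using LU(2)[of "u - 1" c] LV(3)[of "u - 1" c] LW(2)[of "u - 1" c] h \<open>x + 1 < z\<close> by auto
    with c show "Q u (Suc x)"
      unfolding Q_def by (intro exI[of _ c]) simp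
  next
    assume "Q u (Suc x)"
    then show "Q u x"
      unfolding Q_def using Suc_leD by blast
  qed
  have Q_v: "Q (Suc v) w" if "w \<le> x" for w
    using mem(2) that unfolding Q_def by (intro exI[of _ "Suc x"]) simp
  have Q_g: "Q (Suc g) w" if "w \<le> h" for w
    using mem(1) that unfolding Q_def by (intro exI[of _ h]) simp
  have not_Q: "\<not> Q v x" if "s = Diag"
  proof
    assume "Q v x"
    moreover have "v - 1 = g"
      using v' that by simp
    ultimately obtain c where "x \<le> c" "(g, c) \<in> LU \<or> (g, c) \<in> LV \<or> (g, c) \<in> LW"
      unfolding Q_def by auto
    then show False
      using LU(2)[of g c] LV(1)[of g c] LW(1)[of g c] h gh v' that by auto
  qed
  have size: "path_size P = n" "path_size P' = n" and "z \<le> n"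
    using P(1) P'(1) W unfolding path_size_def P_def by (simp_all only: fst_conv) (auto simp: prod_eq_iff)
  have N: "(u, w) \<in> nonstrict_pairs P \<longleftrightarrow>
      1 \<le> u \<and> u < w \<and> w \<le> n \<and> (Q u w \<or> u = Suc x \<and> w \<le> z)" for u w
  proof -
    have "(\<exists>c\<ge>w. (u - 1, c) \<in> lattice_points P) \<longleftrightarrow> Q u w \<or> u - 1 = v \<and> w \<le> x \<or> u - 1 = x \<and> w \<le> z"
      unfolding pts Q_def by blast
    moreover have "Q u w" if "1 \<le> u" "u - 1 = v" "w \<le> x"
      using Q_v[OF that(3)] that by auto
    ultimately show ?thesis
      unfolding nonstrict_pairs_def size by auto
  qed
  have N': "(u, w) \<in> nonstrict_pairs P' \<longleftrightarrow>
      1 \<le> u \<and> u < w \<and> w \<le> n \<and> (Q u w \<or> s = Diag \<and> u = v \<and> w = x \<or> u = Suc x \<and> w < z)" for u w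
  proof -
    have "(\<exists>c\<ge>w. (u - 1, c) \<in> lattice_points P') \<longleftrightarrow>
        Q u w \<or> u - 1 = g \<and> w \<le> x \<or> u - 1 = x \<and> w \<le> z - 1"
      unfolding pts' Q_def by blast
    moreover have "Q u w \<or> s = Diag \<and> u = v \<and> w = x" if "1 \<le> u" "u - 1 = g" "w \<le> x"
    proof (cases "s = North \<or> w \<le> h")
      case True
      then show ?thesis
        using Q_v[OF that(3)] Q_g[of w] that v' by auto
    next
      case False
      then show ?thesis
        using s that v' h by auto
    qed
    ultimately show ?thesis
      using v' \<open>x + 1 < z\<close> unfolding nonstrict_pairs_def size by auto
  qed
  \<comment> \<open>The non-strict edges of \<open>P\<close> except the one between the twins and
    the exceptional one to \<open>z\<close>.\<close>
  define N0 where "N0 = nonstrict_pairs P - {(x, Suc x), (Suc x, z)}"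
  have N_eq: "nonstrict_pairs P = {(x, Suc x), (Suc x, z)} \<union> N0"
    using \<open>x + 1 < z\<close> \<open>z \<le> n\<close> x Q_x by (auto simp: N0_def N)
  have N'_eq: "nonstrict_pairs P' = (if s = Diag then {(v, x)} else {}) \<union> {(x, Suc x)} \<union> N0"
  proof (intro set_eqI; clarify)
    fix u w
    show "(u, w) \<in> nonstrict_pairs P' \<longleftrightarrow>
        (u, w) \<in> (if s = Diag then {(v, x)} else {}) \<union> {(x, Suc x)} \<union> N0"
      using \<open>x + 1 < z\<close> \<open>z \<le> n\<close> x Q_x[of "Suc x"] Q_Suc_x v' gh h s
      by (auto simp: N0_def N N')
  qed
  interpret twin: twin_vertices N0 S x "Suc x" z "{1..n}"
  proof
    show "finite N0" "finite S"
      using pairs_finite[OF P(1)] S by (simp_all add: N0_def P_def)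
    show "N0 \<subseteq> {(u, w). u < w}" "S \<subseteq> {(u, w). u < w}"
      using pairs_inc[of P] P(2) S by (auto simp: N0_def P_def)
    show "adj_swap x ` {1..n} = {1..n}"
      using x \<open>x + 1 < z\<close> \<open>z \<le> n\<close>
      by (intro image_eq_if_involution) (auto simp: Transposition.transpose_def)
    \<comment> \<open>Smaller neighbours of the twins agree by \<open>Q_row\<close>; by
      \<open>Q_x\<close> and \<open>Q_Suc_x\<close> the larger neighbours of each in
      \<open>N0\<close> are the vertices strictly between \<open>Suc x\<close> and
      \<open>z\<close>.\<close>
    show "map_prod (adj_swap x) (adj_swap x) ` N0 = N0"
    proof (rule image_eq_if_involution; clarify)
      fix u w assume "(u, w) \<in> N0"
      then have uw: "1 \<le> u" "u < w" "w \<le> n" "Q u w \<or> u = Suc x \<and> w \<le> z"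
          "(u, w) \<noteq> (x, Suc x)" "(u, w) \<noteq> (Suc x, z)"
        by (simp_all add: N0_def N)
      consider "u = x" | "u = Suc x" | "w = x" | "w = Suc x" "u < x" | "u \<notin> {x, Suc x}" "w \<notin> {x, Suc x}"
        using uw by fastforce
      then show "map_prod (adj_swap x) (adj_swap x) (u, w) \<in> N0"
        using uw x \<open>x + 1 < z\<close> \<open>z \<le> n\<close> Q_Suc_x Q_x[of w] Q_row[of u]
        by cases (auto simp: N0_def N Transposition.transpose_def)
    qed simp
    show "map_prod (adj_swap x) (adj_swap x) ` S = S"
    proof -
      \<comment> \<open>No edge of \<open>S\<close> touches a twin, so the transposition fixes
        \<open>S\<close> pointwise.\<close>
      have "i + 1 < x \<or> Suc x < i + 1" "j + 1 < x \<or> Suc x < j + 1" if "(i, j) \<in> D" for i j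
        using that diag_starts_le[of _ U] diag_starts_le[of _ V] U V gh h x \<open>x + 1 < z\<close> by (force simp: D_def)+
      then have "map_prod (adj_swap x) (adj_swap x) r = r" if "r \<in> S" for r
        using that unfolding S_def by (force simp: Transposition.transpose_def)
      then show ?thesis
        by (simp cong: image_cong)
    qed
  qed (use \<open>x + 1 < z\<close> in auto)
  have bz: "(Suc x, z) \<notin> N0"
    by (simp add: N0_def)
  have va: "(v, x) \<notin> N0" if "s = Diag"
    using not_Q[OF that] N[of v x] gh h by (simp add: N0_def)
  show "LLTe P = (if s = North then q *\<^sub>K LLTe P' else LLTe P')"
  proof (cases "s = North")
    case True
    then show ?thesis
      using twin.graph_sum_exchange[OF bz] S S' N_eq N'_eq
      by (simp add: LLTe_eq_graph_sum[OF P, folded P_def] LLTe_eq_graph_sum[OF P'])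
  next
    case False
    then have "s = Diag"
      using s by simp
    then show ?thesis
      using twin.graph_sum_exchange_below[OF bz va] gh h S S' N_eq N'_eq
      by (simp add: LLTe_eq_graph_sum[OF P, folded P_def] LLTe_eq_graph_sum[OF P'] insert_commute)
  qed
qed

section \<open>Comparing bounce paths at the same point\<close>

lemma prefix_eqI:
  assumes "A @ B = A' @ B'" "endpoint A = endpoint A'"
  shows "A = A'"
proof -
  \<comment> \<open>Every step vector is nonzero with nonnegative entries, so a path visits each
    lattice point only once.\<close>
  have "us = []" if "endpoint us = 0" for us
  proof (cases us)
    case (Cons s us')
    then show ?thesis
      using that by (cases s; cases "endpoint us'") (auto simp: zero_prod_def)
  qed
  then show ?thesis
    using assms by (auto simp: append_eq_append_conv2)
qed

text \<open>A point is visited once, so its two adjacent steps are determined; the rules for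
  continuing and for stopping exclude each other.\<close>

lemma between_diagonals_not_incident_NE:
  assumes "between_diagonals P p"
  shows "\<not> incident_NE P p"
proof
  assume "incident_NE P p"
  then obtain A s B where s: "P = A @ [s] @ B" "s \<in> {North, East}" "endpoint A = p \<or> endpoint (A @ [s]) = p"
    unfolding incident_NE_def by blast
  obtain A' B' where d: "P = (A' @ [Diag]) @ Diag # B'" "endpoint (A' @ [Diag]) = p"
    using assms unfolding between_diagonals_def by auto
  have eq: "A @ [s] @ B = (A' @ [Diag]) @ Diag # B'"
    using s(1) d(1) by (rule trans[OF sym])
  from s(3) show False
  proof
    assume "endpoint A = p"
    with d(2) have "endpoint A = endpoint (A' @ [Diag])"
      by (simp only:)
    then have "A = A' @ [Diag]"
      by (rule prefix_eqI[OF eq])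
    then show False
      using eq s(2) by simp
  next
    assume "endpoint (A @ [s]) = p"
    with d(2) have "endpoint (A @ [s]) = endpoint (A' @ [Diag])"
      by (simp only:)
    then have "A @ [s] = A' @ [Diag]"
      by (rule prefix_eqI[of _ B _ "Diag # B'", rotated]) (use eq in \<open>simp only: append_assoc\<close>)
    then show False
      using s(2) by simp
  qed
qed

lemma between_diagonals_above:
  assumes "steps_above 0 P" "between_diagonals P (i, j)"
  shows "i < j"
proof -
  obtain A B where "P = (A @ [Diag]) @ [Diag] @ B" "endpoint (A @ [Diag]) = (i, j)"
    using assms(2) unfolding between_diagonals_def by auto
  then show ?thesis
    using assms(1) by simp
qed

lemma reach_west_unique:
  assumes "reach_west P u v" "reach_west P u w"
  shows "v = w"
  using assms unfolding reach_west_def by (meson linorder_neqE_nat)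

text \<open>A bounce decomposition comes with its own bounce path. This shows that it too stops
  after one bounce, which fixes where the first factor ends.\<close>

lemma single_bounce_length:
  assumes P: "steps_above 0 P" and us: "bounce_path P p us" "card (bounce_points us) = 1"
    and us': "bounce_path P p us'"
  shows "length us' = 3"
proof -
  obtain k where k: "k \<ge> 1" "length us = k + 2" "p = (us ! 1, us ! 0)"
    "\<And>i. 1 \<le> i \<Longrightarrow> i \<le> k \<Longrightarrow> reach_west P (us ! i) (us ! (i + 1))"
    "\<And>i. 1 \<le> i \<Longrightarrow> i < k \<Longrightarrow> between_diagonals P (us ! (i + 1), us ! i)"
    "incident_NE P (us ! (k + 1), us ! k)"
    using us(1) unfolding bounce_path_def by auto
  obtain l where l: "l \<ge> 1" "length us' = l + 2" "p = (us' ! 1, us' ! 0)"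
    "\<And>i. 1 \<le> i \<Longrightarrow> i \<le> l \<Longrightarrow> reach_west P (us' ! i) (us' ! (i + 1))"
    "\<And>i. 1 \<le> i \<Longrightarrow> i < l \<Longrightarrow> between_diagonals P (us' ! (i + 1), us' ! i)"
    using us' unfolding bounce_path_def by auto
  \<comment> \<open>A second bounce point would be strictly lower than the first, hence distinct
    from it.\<close>
  have "\<not> 1 < k"
  proof
    assume "1 < k"
    then have "us ! 2 < us ! 1"
      using between_diagonals_above[OF P k(5)[of 1]] by (simp add: numeral_2_eq_2)
    moreover have "(us ! i, us ! i) \<in> bounce_points us" if "i \<in> {1, 2}" for i
      unfolding bounce_points_def mem_Collect_eq using that \<open>1 < k\<close> k(2) by (intro exI[of _ i]) auto
    then have "(us ! 1, us ! 1) \<in> bounce_points us" "(us ! 2, us ! 2) \<in> bounce_points us"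
      by simp_all
    ultimately show False
      using us(2) by (metis card_1_singletonE less_irrefl prod.inject singletonD)
  qed
  then have "k = 1"
    using k(1) by simp
  \<comment> \<open>Both paths start at \<open>p\<close> and the first point to the west is unique,
    so they meet the same stopping point.\<close>
  have "us' ! 2 = us ! 2"
    using reach_west_unique[of P "us ! 1"] k(1,3) k(4)[of 1] l(1,3) l(4)[of 1]
    by (simp add: numeral_2_eq_2)
  then have "\<not> between_diagonals P (us' ! 2, us' ! 1)"
    using k(6) l(3) k(3) \<open>k = 1\<close> between_diagonals_not_incident_NE[of P "(us ! 2, us ! 1)"]
    by (auto simp: numeral_2_eq_2)
  then have "\<not> 1 < l"
    using l(5)[of 1] by (auto simp: numeral_2_eq_2)
  then show ?thesis
    using l(1,2) by simp
qed

theorem theorem2p9: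
  fixes F :: "step list \<Rightarrow> K sym_fun"
  assumes F: "\<And>P. P \<in> SCH \<Longrightarrow> F P = LLTe P"
  shows "(\<forall>k. F ([North] @ replicate k Diag @ [East]) = elem_sym (k + 1)) \<and>
    (\<forall>P\<in>SCH. \<forall>Q\<in>SCH. F (P @ Q) = F P * F Q) \<and>
    (\<forall>U V. U @ [Diag] @ V \<in> SCH \<longrightarrow>
       F (U @ [North, East] @ V) - F (U @ [East, North] @ V) = (q - 1) *\<^sub>K F (U @ [Diag] @ V)) \<and>
    (\<forall>P\<in>SCH. \<forall>x z us U s t V W.
       (x, z) \<in> lattice_points P \<and> x + 1 < z \<and>
       bounce_path P (x, z) us \<and> card (bounce_points us) = 1 \<and>
       bounce_decomposition P (x, z) U s t V Diag East W \<and>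
       set V \<subseteq> {North, Diag} \<and> (s, t) \<in> {(North, North), (Diag, North)} \<longrightarrow>
       ((s, t) = (North, North) \<longrightarrow> F P = q *\<^sub>K F (U @ [North, North] @ V @ [East, Diag] @ W)) \<and>
       ((s, t) = (Diag, North) \<longrightarrow> F P = F (U @ [North, Diag] @ V @ [East, Diag] @ W)))"
proof (intro conjI allI ballI impI; (elim conjE)?)
  fix k
  show "F ([North] @ replicate k Diag @ [East]) = elem_sym (k + 1)"
    using LLTe_north_diags_east[of k] north_diags_east_path[of k] by (simp add: F SCH_iff)
next
  fix P Q assume "P \<in> SCH" "Q \<in> SCH"
  \<comment> \<open>\<open>F\<close> is prescribed on \<open>SCH\<close> only, so membership has to
    precede every evaluation.\<close>
  moreover from this have "P @ Q \<in> SCH"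
    unfolding SCH_iff using LLTe_append(1,2) by blast
  ultimately show "F (P @ Q) = F P * F Q"
    using LLTe_append(3) by (auto simp: F SCH_iff)
next
  fix U V assume P: "U @ [Diag] @ V \<in> SCH"
  moreover from this have "U @ [North, East] @ V \<in> SCH" "U @ [East, North] @ V \<in> SCH"
    unfolding SCH_iff using LLTe_corner(1-4) by blast+
  ultimately show "F (U @ [North, East] @ V) - F (U @ [East, North] @ V) = (q - 1) *\<^sub>K F (U @ [Diag] @ V)"
    using LLTe_corner(5) unfolding SCH_iff[of "U @ [Diag] @ V"] by (metis F P)
next
  fix P x z us U s t V W
  assume "P \<in> SCH" and "x + 1 < z" and us: "bounce_path P (x, z) us" "card (bounce_points us) = 1"
    and dec: "bounce_decomposition P (x, z) U s t V Diag East W"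
    and st: "(s, t) \<in> {(North, North), (Diag, North)}"
  then obtain n where P: "endpoint P = (n, n)" "steps_above 0 P"
    by (auto simp: SCH_iff)
  obtain us' where us': "P = U @ [s, t] @ V @ [Diag, East] @ W" "bounce_path P (x, z) us'"
    "endpoint (U @ [s]) = (us' ! (length us' - 1), us' ! (length us' - 2))"
    "endpoint (U @ [s, t] @ V @ [Diag]) = (x, z)"
    using dec unfolding bounce_decomposition_def by auto
  have "length us' = 3"
    using single_bounce_length[OF P(2) us us'(2)] .
  moreover have "us' ! 1 = x"
    using us'(2) unfolding bounce_path_def by auto
  \<comment> \<open>With length 3 the last two entries are \<open>us' ! 2\<close> and
    \<open>us' ! 1\<close>, so the first factor ends at height \<open>x\<close>.\<close>
  ultimately have v: "endpoint (U @ [s]) = (us' ! 2, x)"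
    using us'(3) by simp
  have "s \<in> {North, Diag}" "t = North"
    using st by auto
  note bounce = LLTe_bounce[OF P[unfolded us'(1) \<open>t = North\<close>] \<open>s \<in> {North, Diag}\<close> v
      us'(4)[unfolded \<open>t = North\<close>] \<open>x + 1 < z\<close>]
  have P': "U @ [North, s] @ V @ [East, Diag] @ W \<in> SCH"
    unfolding SCH_iff using bounce(1,2) by blast
  have eq: "F P = (if s = North then q *\<^sub>K F (U @ [North, s] @ V @ [East, Diag] @ W)
      else F (U @ [North, s] @ V @ [East, Diag] @ W))"
    unfolding F[OF \<open>P \<in> SCH\<close>] F[OF P']
    using bounce(3) us'(1) \<open>t = North\<close> by simp
  show "F P = q *\<^sub>K F (U @ [North, North] @ V @ [East, Diag] @ W)" if "(s, t) = (North, North)"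
    using eq that by simp
  show "F P = F (U @ [North, Diag] @ V @ [East, Diag] @ W)" if "(s, t) = (Diag, North)"
    using eq that by simp
qed

end
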